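(* Let $\Bbbk$ be a field, $S=\Bbbk[x_1,\ldots,x_n]$, and let $I\subseteq S$ be a monomial ideal with set of minimal monomial generators $\mathcal{G}(I)$ and Buchberger complex $\mathfrak{Bu}(I)$. Then the Buchberger resolution $\mathcal{F}_{\mathfrak{Bu}(I)}$ is a minimal free resolution of $I$ if and only if whenever $F,G\subseteq\mathcal{G}(I)$ with $F\neq G$ are such that $\mathbf{m}_F=\mathbf{m}_G$, there is a monomial $u\in\mathcal{G}(I)$ such that $u$ properly divides $\mathbf{m}_F=\mathbf{m}_G$.
   Context: For a finite set $F$ of monomials, $\mathbf{m}_F$ denotes the least common multiple of the elements of $F$ (with $\mathbf{m}_\emptyset=1$). For monomials $u=x_1^{u_1}\cdots x_n^{u_n}$ and $v=x_1^{v_1}\cdots x_n^{v_n}$, $u$ properly divides $v$ (written $u\mid_p v$) if $u$ divides $v$, $u_i<v_i$ for all $i$ with $v_i\neq 0$, and $u_i=v_i$ for all $i$ with $v_i=0$. The Buchberger complex $\mathfrak{Bu}(I)$ is the simplicial complex consisting of all subsets $F\subseteq\mathcal{G}(I)$ such that no $u\in\mathcal{G}(I)$ properly divides $\mathbf{m}_F$. For a simplicial complex $\Delta$ with vertex set $\mathcal{G}(I)$, each face $F$ is labeled by $\mathbf{m}_F$. The complex $\mathcal{F}_\Delta$ is the $\mathbb{N}^n$-graded simplicial chain complex of $\Delta$ homogenized over $S$: it has a free generator $e_F$ in multidegree $\mathbf{m}_F$ and homological degree $|F|-1$ for each nonempty face $F$, with differential $\partial(e_F)=\sum_{v\in F}\pm\frac{\mathbf{m}_F}{\mathbf{m}_{F\setminus\{v\}}}e_{F\setminus\{v\}}$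 for $|F|\ge 2$ (signs from the usual simplicial boundary map after fixing an order on the vertices), augmented to $I$ by $e_{\{v\}}\mapsto v$. The complex $\mathcal{F}_{\mathfrak{Bu}(I)}$ supported on the Buchberger complex is called the Buchberger resolution of $I$.
   Formalization: The ideal I is assumed proper: for I = S, 1 properly divides m_∅ = 1, so the Buchberger complex has no faces and does not resolve S, although the condition on F and G holds. The number of variables n is at least 1. *)

theory Defs
  imports Complex_Main "HOL-Library.Poly_Mapping"
begin

section \<open>Monomials and polynomials\<close>

text \<open>The finite type \<open>'n\<close> indexes the variables. A monomial is represented by its exponent
  vector, so the product of monomials is \<open>+\<close> and the monomial \<open>1\<close> is \<open>0\<close>. The polynomial
  ring \<open>S\<close> is the monoid algebra of the exponent vectors.\<close>

type_synonym 'n monom = "'n \<Rightarrow>\<^sub>0 nat"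
type_synonym ('n, 'k) mpoly = "('n \<Rightarrow>\<^sub>0 nat) \<Rightarrow>\<^sub>0 'k"

definition mon :: "'n monom \<Rightarrow> ('n, 'k::field) mpoly" where
  "mon u = Poly_Mapping.single u 1"

definition mdvd :: "'n monom \<Rightarrow> 'n monom \<Rightarrow> bool" (infix \<open>mdvd\<close> 50) where
  "u mdvd v \<longleftrightarrow> (\<forall>i. Poly_Mapping.lookup u i \<le> Poly_Mapping.lookup v i)"

definition pdvd :: "'n monom \<Rightarrow> 'n monom \<Rightarrow> bool" (infix \<open>pdvd\<close> 50) where
  "u pdvd v \<longleftrightarrow> u mdvd v \<and> (\<forall>i. Poly_Mapping.lookup v i \<noteq> 0 \<longrightarrow> Poly_Mapping.lookup u i < Poly_Mapping.lookup v i)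
     \<and> (\<forall>i. Poly_Mapping.lookup v i = 0 \<longrightarrow> Poly_Mapping.lookup u i = Poly_Mapping.lookup v i)"

text \<open>The supremum in \<open>nat\<close> of a finite set is its maximum, and \<open>0\<close> for the empty set; hence
  \<open>mlcm {}\<close> is the monomial \<open>1\<close>. Only finite \<open>F\<close> are meaningful here.\<close>

definition mlcm :: "'n::finite monom set \<Rightarrow> 'n monom" where
  "mlcm F = Abs_poly_mapping (\<lambda>i. SUP u\<in>F. Poly_Mapping.lookup u i)"


section \<open>Monomial ideals\<close>

interpretation poly: module "(*) :: ('n, 'k::field) mpoly \<Rightarrow> ('n, 'k) mpoly \<Rightarrow> ('n, 'k) mpoly"
  by standard (simp_all only: distrib_left distrib_right mult.assoc mult_1_left)

definition monomial_ideal :: "('n, 'k::field) mpoly set \<Rightarrow> bool" where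
  "monomial_ideal I \<longleftrightarrow> (\<exists>A. I = poly.span (mon ` A))"

definition min_gens :: "('n, 'k::field) mpoly set \<Rightarrow> 'n monom set" where
  "min_gens I = {u. mon u \<in> I \<and> (\<forall>w. mon w \<in> I \<and> w mdvd u \<longrightarrow> w = u)}"

definition max_ideal :: "('n, 'k::field) mpoly set" where
  "max_ideal = poly.span ((\<lambda>i. mon (Poly_Mapping.single i 1)) ` UNIV)"


section \<open>Multigraded free resolutions\<close>

text \<open>\<open>'b \<Rightarrow>\<^sub>0 ('n, 'k) mpoly\<close> is the free \<open>S\<close>-module on the type \<open>'b\<close>, and \<open>free_mod B\<close> is
  its direct summand with basis \<open>B\<close>.\<close>

definition smult :: "('n, 'k::field) mpoly \<Rightarrow> ('b \<Rightarrow>\<^sub>0 ('n, 'k) mpoly) \<Rightarrow> 'b \<Rightarrow>\<^sub>0 ('n, 'k) mpoly" where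
  "smult p v = Poly_Mapping.map ((*) p) v"

lemma lookup_smult [simp]: "Poly_Mapping.lookup (smult p v) b = p * Poly_Mapping.lookup v b"
  by (simp add: smult_def Poly_Mapping.map.rep_eq when_def)

interpretation fmod: module "smult :: ('n, 'k::field) mpoly \<Rightarrow> ('b \<Rightarrow>\<^sub>0 ('n, 'k) mpoly) \<Rightarrow> _"
  by standard (rule poly_mapping_eqI,
      simp only: lookup_smult Poly_Mapping.lookup_add distrib_left distrib_right mult.assoc mult_1_left)+

definition free_mod :: "'b set \<Rightarrow> ('b \<Rightarrow>\<^sub>0 ('n, 'k::field) mpoly) set" where
  "free_mod B = {v. Poly_Mapping.keys v \<subseteq> B}"

text \<open>If the basis element \<open>b\<close> sits in multidegree \<open>deg b\<close>, an element is homogeneous of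
  multidegree \<open>a\<close> iff its coefficient at each \<open>b\<close> is a scalar multiple of \<open>x\<^sup>a / x\<^bsup>deg b\<^esup>\<close>
  (and \<open>0\<close> if \<open>x\<^bsup>deg b\<^esup>\<close> does not divide \<open>x\<^sup>a\<close>).\<close>

definition homogeneous :: "('b \<Rightarrow> 'n monom) \<Rightarrow> 'n monom \<Rightarrow> ('b \<Rightarrow>\<^sub>0 ('n, 'k::field) mpoly) \<Rightarrow> bool" where
  "homogeneous deg a v \<longleftrightarrow> (\<forall>b. \<exists>c. Poly_Mapping.lookup v b * mon (deg b) = Poly_Mapping.single a c)"

text \<open>The complex
  \<open>\<dots> \<rightarrow> free_mod (B 2) \<rightarrow> free_mod (B 1) \<rightarrow> free_mod (B 0) \<rightarrow> I \<rightarrow> 0\<close>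
  with differentials \<open>d\<close> and augmentation \<open>eps\<close>. The maps are taken linear on the ambient free
  module, which is no restriction because each \<open>free_mod (B i)\<close> is a direct summand of it.\<close>

definition free_resolution ::
  "('n, 'k::field) mpoly set \<Rightarrow> (nat \<Rightarrow> 'b set) \<Rightarrow> ('b \<Rightarrow> 'n monom) \<Rightarrow>
   (nat \<Rightarrow> ('b \<Rightarrow>\<^sub>0 ('n, 'k) mpoly) \<Rightarrow> 'b \<Rightarrow>\<^sub>0 ('n, 'k) mpoly) \<Rightarrow>
   (('b \<Rightarrow>\<^sub>0 ('n, 'k) mpoly) \<Rightarrow> ('n, 'k) mpoly) \<Rightarrow> bool" where
  "free_resolution I B deg d eps \<longleftrightarrow>
     (\<forall>i. module_hom smult smult (d i)) \<and> module_hom smult (*) eps \<and>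
     (\<forall>i a v. v \<in> free_mod (B (Suc i)) \<and> homogeneous deg a v \<longrightarrow> homogeneous deg a (d (Suc i) v)) \<and>
     (\<forall>a v. v \<in> free_mod (B 0) \<and> homogeneous deg a v \<longrightarrow> (\<exists>c. eps v = Poly_Mapping.single a c)) \<and>
     eps ` free_mod (B 0) = I \<and>
     d 1 ` free_mod (B 1) = {v \<in> free_mod (B 0). eps v = 0} \<and>
     (\<forall>i. d (i + 2) ` free_mod (B (i + 2)) = {v \<in> free_mod (B (i + 1)). d (i + 1) v = 0})"

definition minimal_free_resolution ::
  "('n, 'k::field) mpoly set \<Rightarrow> (nat \<Rightarrow> 'b set) \<Rightarrow> ('b \<Rightarrow> 'n monom) \<Rightarrow>
   (nat \<Rightarrow> ('b \<Rightarrow>\<^sub>0 ('n, 'k) mpoly) \<Rightarrow> 'b \<Rightarrow>\<^sub>0 ('n, 'k) mpoly) \<Rightarrow>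
   (('b \<Rightarrow>\<^sub>0 ('n, 'k) mpoly) \<Rightarrow> ('n, 'k) mpoly) \<Rightarrow> bool" where
  "minimal_free_resolution I B deg d eps \<longleftrightarrow>
     free_resolution I B deg d eps \<and>
     (\<forall>i. d (Suc i) ` free_mod (B (Suc i))
            \<subseteq> fmod.span {smult p v | p v. p \<in> max_ideal \<and> v \<in> free_mod (B i)})"


section \<open>The complex supported on a labeled simplicial complex\<close>

definition buchberger_complex :: "('n::finite, 'k::field) mpoly set \<Rightarrow> 'n monom set set" where
  "buchberger_complex I = {F. F \<subseteq> min_gens I \<and> \<not> (\<exists>u\<in>min_gens I. u pdvd mlcm F)}"

definition faces :: "'v set set \<Rightarrow> nat \<Rightarrow> 'v set set" where
  "faces D i = {F \<in> D. finite F \<and> card F = i + 1}"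

text \<open>Signs come from the vertex order \<open>r\<close>: the sign at \<open>v\<close> is \<open>(-1)\<^sup>j\<close>, where \<open>j\<close> counts the
  vertices of \<open>F\<close> before \<open>v\<close>. The difference of exponent vectors is the quotient of monomials.\<close>

definition bd_basis :: "'n monom rel \<Rightarrow> 'n::finite monom set \<Rightarrow>
    'n monom set \<Rightarrow>\<^sub>0 ('n, 'k::field) mpoly" where
  "bd_basis r F = (\<Sum>v\<in>F. Poly_Mapping.single (F - {v})
     ((-1) ^ card {w \<in> F. (w, v) \<in> r \<and> w \<noteq> v} * mon (mlcm F - mlcm (F - {v}))))"

text \<open>Only \<open>bd r i\<close> with \<open>i \<ge> 1\<close> occurs in the complex, on faces with at least two
  vertices. Similarly \<open>aug\<close> is applied to one-vertex faces \<open>F = {v}\<close> only, where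
  \<open>mlcm F = v\<close>.\<close>

definition bd :: "'n monom rel \<Rightarrow> nat \<Rightarrow> ('n::finite monom set \<Rightarrow>\<^sub>0 ('n, 'k::field) mpoly) \<Rightarrow>
    'n monom set \<Rightarrow>\<^sub>0 ('n, 'k) mpoly" where
  "bd r i x = (if i = 0 then 0 else \<Sum>F\<in>Poly_Mapping.keys x. smult (Poly_Mapping.lookup x F) (bd_basis r F))"

definition aug :: "('n::finite monom set \<Rightarrow>\<^sub>0 ('n, 'k::field) mpoly) \<Rightarrow> ('n, 'k) mpoly" where
  "aug x = (\<Sum>F\<in>Poly_Mapping.keys x. Poly_Mapping.lookup x F * mon (mlcm F))"

end

theory Submission
  imports Defs
begin

text \<open>Call the least common multiple of a face its label. The claim splits into two parts: the
  Buchberger complex always supports a resolution, and this resolution is minimal iff removing a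
  vertex from a face with at least two vertices always changes the label.

  For the first part, multiplying the basis element of each face by its label embeds the homogenized
  complex into the ordinary simplicial chains with polynomial coefficients (\<open>dehomogenize_bd\<close>), and
  the augmentation becomes the boundary map to the empty face. Exactness can then be checked for one
  monomial \<open>a\<close> at a time, as acyclicity of the subcomplex of faces with label dividing \<open>a\<close>
  (\<open>buchberger_faces_acyclic\<close>). A cycle \<open>c\<close> there is the boundary of the cone over \<open>c\<close> whose apex
  is any generator dividing \<open>a\<close>, but this cone may leave the Buchberger complex. A face outside the
  complex has a label \<open>m\<close> with a properly dividing generator \<open>u\<close>. Adding or removing \<open>u\<close> preserves the label \<open>m\<close>, since \<open>u\<close> attains
  no positive exponent of \<open>m\<close>. Hence the faces with label \<open>m\<close> form an acyclic piece, contracted by the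
  cone over \<open>u\<close>, and subtracting a boundary replaces them by faces with smaller labels
  (\<open>remove_nonface_label\<close>). Working downwards from the maximal labels pushes the chain into the
  Buchberger complex (\<open>push_into_buchberger_faces\<close>).

  For the second part, the entry of the differential from \<open>F\<close> to \<open>F - {v}\<close> is a unit iff both have the
  same label, so minimality means that labels of nonempty faces are strictly monotone
  (\<open>bd_minimal_iff\<close>). Two different sets of generators with the same label and no proper divisor of
  it would have as their union a face whose label survives the removal of some vertex; conversely such a
  face and its facet are two such sets (\<open>strict_labels_iff\<close>).\<close>

section \<open>Divisibility of monomials\<close>

lemma mdvd_refl [simp]: "u mdvd u"
  by (simp add: mdvd_def)

lemma mdvd_trans: "u mdvd v \<Longrightarrow> v mdvd w \<Longrightarrow> u mdvd w"
  unfolding mdvd_def by (meson order_trans)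

lemma mdvd_antisym: "u mdvd v \<Longrightarrow> v mdvd u \<Longrightarrow> u = v"
  by (auto simp: mdvd_def intro: poly_mapping_eqI antisym)

lemma zero_mdvd [simp]: "0 mdvd u"
  by (simp add: mdvd_def)

lemma mdvd_add [simp]: "u mdvd a + u"
  by (simp add: mdvd_def lookup_add)

lemma mdvd_diff_add: "u mdvd v \<Longrightarrow> v - u + u = v"
  by (rule poly_mapping_eqI) (simp add: mdvd_def lookup_add lookup_minus)

lemma pdvd_imp_mdvd: "u pdvd v \<Longrightarrow> u mdvd v"
  by (simp add: pdvd_def)

text \<open>This is what makes the Buchberger complex closed under subsets: a proper divisor of the label of
  a face properly divides the label of every larger face.\<close>

lemma pdvd_mdvd_trans:
  assumes "u pdvd v" "v mdvd w"
  shows "u pdvd w"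
proof -
  have "Poly_Mapping.lookup u i = 0 \<or> Poly_Mapping.lookup u i < Poly_Mapping.lookup w i" for i
    using assms unfolding pdvd_def mdvd_def
    by (metis gr0I order_less_le_trans)
  then show ?thesis
    unfolding pdvd_def mdvd_def by (metis gr0I le_eq_less_or_eq not_less_zero zero_le)
qed

text \<open>A strictly monotone measure for divisibility, so that minimal and maximal monomials can be chosen
  by comparing natural numbers.\<close>

definition total_degree :: "'n::finite monom \<Rightarrow> nat" where
  "total_degree u = (\<Sum>i\<in>UNIV. Poly_Mapping.lookup u i)"

lemma total_degree_less:
  assumes "u mdvd v" "u \<noteq> v"
  shows "total_degree u < total_degree v"
proof -
  obtain i where "Poly_Mapping.lookup u i \<noteq> Poly_Mapping.lookup v i"
    using assms(2) by (metis poly_mapping_eqI)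
  with assms(1) have "Poly_Mapping.lookup u i < Poly_Mapping.lookup v i"
    by (simp add: mdvd_def order.strict_iff_order)
  then show ?thesis
    using assms(1) unfolding total_degree_def mdvd_def by (intro sum_strict_mono_ex1) auto
qed

lemma lookup_mlcm: "Poly_Mapping.lookup (mlcm F) i = (SUP u\<in>F. Poly_Mapping.lookup u i)"
  by (simp add: mlcm_def)

lemma mlcm_mdvd_iff:
  assumes "finite F"
  shows "mlcm F mdvd a \<longleftrightarrow> (\<forall>u\<in>F. u mdvd a)"
proof (cases "F = {}")
  case True
  then show ?thesis by (simp add: mdvd_def lookup_mlcm)
next
  case False
  have "(SUP u\<in>F. Poly_Mapping.lookup u i) \<le> k \<longleftrightarrow> (\<forall>u\<in>F. Poly_Mapping.lookup u i \<le> k)" for i k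
    using assms False by (subst cSup_le_iff) (auto intro: bdd_above_finite)
  then show ?thesis
    by (auto simp: mdvd_def lookup_mlcm)
qed

lemma mdvd_mlcm: "finite F \<Longrightarrow> u \<in> F \<Longrightarrow> u mdvd mlcm F"
  using mlcm_mdvd_iff mdvd_refl by blast

lemma mlcm_mono: "finite G \<Longrightarrow> F \<subseteq> G \<Longrightarrow> mlcm F mdvd mlcm G"
  by (subst mlcm_mdvd_iff) (auto intro: mdvd_mlcm finite_subset)

lemma mlcm_empty [simp]: "mlcm {} = 0"
  by (rule poly_mapping_eqI) (simp add: lookup_mlcm)

lemma mlcm_singleton [simp]: "mlcm {u} = u"
  by (rule poly_mapping_eqI) (simp add: lookup_mlcm)

text \<open>A proper divisor of the least common multiple does not attain its exponent in any variable
  that occurs, so another element of the set already does.\<close>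

lemma mlcm_remove_pdvd:
  assumes "finite F" "u pdvd mlcm F"
  shows "mlcm (F - {u}) = mlcm F"
proof (rule mdvd_antisym)
  show "mlcm (F - {u}) mdvd mlcm F"
    using assms by (intro mlcm_mono) auto
  have "Poly_Mapping.lookup (mlcm F) i \<le> Poly_Mapping.lookup (mlcm (F - {u})) i" for i
  proof (cases "Poly_Mapping.lookup (mlcm F) i = 0")
    case False
    then have "F \<noteq> {}" by auto
    then have "Poly_Mapping.lookup (mlcm F) i \<in> (\<lambda>v. Poly_Mapping.lookup v i) ` F"
      unfolding lookup_mlcm using assms(1) cSup_eq_Max by (metis Max_in finite_imageI image_is_empty)
    then obtain v where "v \<in> F" "Poly_Mapping.lookup (mlcm F) i = Poly_Mapping.lookup v i"
      by blast
    moreover from this have "v \<noteq> u"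
      using assms(2) False unfolding pdvd_def by (metis less_irrefl)
    ultimately show ?thesis
      using mdvd_mlcm[of "F - {u}" v] assms(1) by (auto simp: mdvd_def)
  qed simp
  then show "mlcm F mdvd mlcm (F - {u})"
    by (simp add: mdvd_def)
qed

text \<open>Every sequence has a monotone subsequence, and a decreasing sequence of natural numbers is
  eventually constant.\<close>

lemma nat_seq_incseq_subseq:
  fixes s :: "nat \<Rightarrow> nat"
  shows "\<exists>f. strict_mono f \<and> incseq (\<lambda>n. s (f n))"
proof -
  obtain f where f: "strict_mono f" "monoseq (\<lambda>n. s (f n))"
    using seq_monosub by blast
  show ?thesis
  proof (cases "incseq (\<lambda>n. s (f n))")
    case False
    then have dec: "decseq (\<lambda>n. s (f n))"
      using f(2) by (simp add: monoseq_iff)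
    obtain N where N: "\<And>n. s (f N) \<le> s (f n)"
      using ex_has_least_nat[of "\<lambda>_. True" _ "\<lambda>n. s (f n)"] by auto
    have "s (f (N + n)) = s (f N)" for n
      using N dec by (simp add: antisym decseq_def)
    moreover have "strict_mono (\<lambda>n. f (N + n))"
      using f(1) by (simp add: strict_mono_def)
    ultimately show ?thesis
      by (intro exI[of _ "\<lambda>n. f (N + n)"]) (simp add: incseq_def)
  qed (use f in blast)
qed

text \<open>Composing subsequences, one for each variable in turn, does not destroy the monotonicity
  already achieved.\<close>

lemma monom_seq_increasing_subseq:
  fixes s :: "nat \<Rightarrow> 'n monom"
  assumes "finite J"
  shows "\<exists>f. strict_mono f \<and> (\<forall>i\<in>J. incseq (\<lambda>n. Poly_Mapping.lookup (s (f n)) i))"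
  using assms
proof (induction J)
  case empty
  show ?case by (auto intro: exI[of _ id] simp: strict_mono_def)
next
  case (insert j J)
  then obtain f where f: "strict_mono f" "\<forall>i\<in>J. incseq (\<lambda>n. Poly_Mapping.lookup (s (f n)) i)"
    by blast
  obtain g where g: "strict_mono g" "incseq (\<lambda>n. Poly_Mapping.lookup (s (f (g n))) j)"
    using nat_seq_incseq_subseq[of "\<lambda>n. Poly_Mapping.lookup (s (f n)) j"] by blast
  have "incseq (\<lambda>n. Poly_Mapping.lookup (s (f (g n))) i)" if "i \<in> J" for i
    using f(2) that strict_mono_less_eq[OF g(1)] by (auto simp: incseq_def)
  moreover have "strict_mono (\<lambda>n. f (g n))"
    using f(1) g(1) by (simp add: strict_mono_def)
  ultimately show ?case
    using g(2) by (intro exI[of _ "\<lambda>n. f (g n)"]) simp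
qed

text \<open>Dickson's lemma: an infinite set of monomials contains a sequence of distinct elements, and in a
  subsequence with all exponents increasing the first term divides the second.\<close>

lemma finite_mdvd_antichain:
  fixes A :: "'n::finite monom set"
  assumes "\<And>u v. u \<in> A \<Longrightarrow> v \<in> A \<Longrightarrow> u mdvd v \<Longrightarrow> u = v"
  shows "finite A"
proof (rule ccontr)
  assume "infinite A"
  then obtain s :: "nat \<Rightarrow> 'n monom" where s: "inj s" "range s \<subseteq> A"
    using infinite_countable_subset[of A] by auto
  obtain f where f: "strict_mono f" "\<forall>i\<in>UNIV. incseq (\<lambda>n. Poly_Mapping.lookup (s (f n)) i)"
    using monom_seq_increasing_subseq[of UNIV s] by auto
  then have "s (f 0) mdvd s (f 1)"
    by (simp add: mdvd_def incseq_def)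
  then have "s (f 0) = s (f 1)"
    using s(2) assms by blast
  then have "f 0 = f 1"
    using s(1) by (simp add: inj_eq)
  then show False
    using f(1) by (simp add: strict_mono_eq)
qed


section \<open>Monomial ideals\<close>

lemma sum_single_lookup:
  "(\<Sum>a\<in>Poly_Mapping.keys p. Poly_Mapping.single a (Poly_Mapping.lookup p a)) = p"
  by (rule poly_mapping_eqI) (simp add: lookup_sum lookup_single when_def in_keys_iff)

lemma lookup_times_mon:
  "Poly_Mapping.lookup (p * mon m) a
     = (if m mdvd a then Poly_Mapping.lookup p (a - m) else 0)"
proof -
  have iff: "b + m = a \<longleftrightarrow> m mdvd a \<and> b = a - m" for b
    using mdvd_diff_add[of m a] by auto
  have "p * mon m = (\<Sum>b\<in>Poly_Mapping.keys p. Poly_Mapping.single (b + m) (Poly_Mapping.lookup p b))"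
    by (subst sum_single_lookup[symmetric]) (simp add: sum_distrib_right mon_def mult_single)
  then show ?thesis
    by (simp add: lookup_sum lookup_single when_def iff in_keys_iff)
qed

lemma mem_span_mon_iff:
  fixes p :: "('n, 'k::field) mpoly"
  shows "p \<in> poly.span (mon ` A) \<longleftrightarrow> (\<forall>a\<in>Poly_Mapping.keys p. \<exists>g\<in>A. g mdvd a)"
proof
  assume "p \<in> poly.span (mon ` A)"
  then show "\<forall>a\<in>Poly_Mapping.keys p. \<exists>g\<in>A. g mdvd a"
  proof (induction rule: poly.span_induct_alt)
    case (step c x y)
    then obtain g where g: "g \<in> A" "x = mon g" by blast
    have "\<exists>g\<in>A. g mdvd a" if "a \<in> Poly_Mapping.keys (c * mon g)" for a
      using that g(1) by (auto simp: in_keys_iff lookup_times_mon split: if_splits)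
    moreover have "Poly_Mapping.keys (c * x + y) \<subseteq> Poly_Mapping.keys (c * mon g) \<union> Poly_Mapping.keys y"
      unfolding g(2) by (rule keys_add)
    ultimately show ?case
      using step.IH by (meson UnE subsetD)
  qed simp
next
  assume keys: "\<forall>a\<in>Poly_Mapping.keys p. \<exists>g\<in>A. g mdvd a"
  have "Poly_Mapping.single a c \<in> poly.span (mon ` A)" if a: "a \<in> Poly_Mapping.keys p" for a and c :: 'k
  proof -
    obtain g where g: "g \<in> A" "g mdvd a"
      using keys a by blast
    have "Poly_Mapping.single (a - g) c * mon g \<in> poly.span (mon ` A)"
      using g(1) by (intro poly.span_scale poly.span_base imageI)
    then show ?thesis
      using g(2) by (simp add: mon_def mult_single mdvd_diff_add)
  qed
  then have "(\<Sum>a\<in>Poly_Mapping.keys p. Poly_Mapping.single a (Poly_Mapping.lookup p a))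
      \<in> poly.span (mon ` A)"
    by (rule poly.span_sum)
  then show "p \<in> poly.span (mon ` A)"
    by (simp only: sum_single_lookup)
qed

lemma mon_mem_span_iff: "(mon a :: ('n, 'k::field) mpoly) \<in> poly.span (mon ` A) \<longleftrightarrow> (\<exists>g\<in>A. g mdvd a)"
  by (simp add: mem_span_mon_iff) (simp add: mon_def)

lemma finite_min_gens: "finite (min_gens (I :: ('n::finite, 'k::field) mpoly set))"
  by (rule finite_mdvd_antichain) (auto simp: min_gens_def)

lemma min_gens_divides:
  fixes I :: "('n::finite, 'k::field) mpoly set"
  assumes "mon a \<in> I"
  shows "\<exists>u\<in>min_gens I. u mdvd a"
proof -
  obtain u where u: "mon u \<in> I" "u mdvd a"
      and least: "\<And>w. mon w \<in> I \<Longrightarrow> w mdvd a \<Longrightarrow> total_degree u \<le> total_degree w"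
    using ex_has_least_nat[of "\<lambda>w. mon w \<in> I \<and> w mdvd a" a total_degree] assms by auto
  have "w = u" if "mon w \<in> I" "w mdvd u" for w
    using least[OF that(1) mdvd_trans[OF that(2) u(2)]] total_degree_less[OF that(2)]
    by (meson leD)
  then show ?thesis
    using u by (auto simp: min_gens_def)
qed

lemma monomial_ideal_mem_iff:
  fixes I :: "('n::finite, 'k::field) mpoly set"
  assumes "monomial_ideal I"
  shows "p \<in> I \<longleftrightarrow> (\<forall>a\<in>Poly_Mapping.keys p. \<exists>u\<in>min_gens I. u mdvd a)"
proof -
  obtain A where I: "I = poly.span (mon ` A)"
    using assms by (auto simp: monomial_ideal_def)
  have "(\<exists>g\<in>A. g mdvd a) \<longleftrightarrow> (\<exists>u\<in>min_gens I. u mdvd a)" for a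
  proof -
    have mem: "mon b \<in> I \<longleftrightarrow> (\<exists>g\<in>A. g mdvd b)" for b
      unfolding I by (rule mon_mem_span_iff)
    have "\<exists>g\<in>A. g mdvd a" if "u \<in> min_gens I" "u mdvd a" for u
      using that mem[of u] mdvd_trans[OF _ that(2)] by (auto simp: min_gens_def)
    then show ?thesis
      using mem[of a] mem min_gens_divides[of a I] by blast
  qed
  then have "p \<in> poly.span (mon ` A) \<longleftrightarrow> (\<forall>a\<in>Poly_Mapping.keys p. \<exists>u\<in>min_gens I. u mdvd a)"
    by (simp add: mem_span_mon_iff)
  then show ?thesis
    by (simp add: I[symmetric])
qed

lemma zero_notin_min_gens:
  fixes I :: "('n::finite, 'k::field) mpoly set"
  assumes "monomial_ideal I" "I \<noteq> UNIV"
  shows "0 \<notin> min_gens I"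
proof
  assume "0 \<in> min_gens I"
  then have "p \<in> I" for p
    unfolding monomial_ideal_mem_iff[OF assms(1)] by (intro ballI bexI[of _ 0]) simp_all
  then show False
    using assms(2) by blast
qed

lemma mem_max_ideal_iff:
  fixes p :: "('n, 'k::field) mpoly"
  shows "p \<in> max_ideal \<longleftrightarrow> Poly_Mapping.lookup p 0 = 0"
proof -
  have iff: "(\<exists>i. Poly_Mapping.single i 1 mdvd a) \<longleftrightarrow> a \<noteq> 0" for a :: "'n monom"
  proof
    assume "a \<noteq> 0"
    then obtain i where "Poly_Mapping.lookup a i \<noteq> 0"
      by (metis lookup_zero poly_mapping_eqI)
    then have "Poly_Mapping.single i 1 mdvd a"
      by (simp add: mdvd_def lookup_single when_def)
    then show "\<exists>i. Poly_Mapping.single i 1 mdvd a" ..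
  next
    assume "\<exists>i. Poly_Mapping.single i 1 mdvd a"
    then obtain i where i: "Poly_Mapping.single i 1 mdvd a" ..
    have "1 \<le> Poly_Mapping.lookup a i"
      using i[unfolded mdvd_def, THEN spec, of i] by simp
    then show "a \<noteq> 0" by auto
  qed
  have max_ideal_eq: "max_ideal = poly.span (mon ` range (\<lambda>i. Poly_Mapping.single i 1) :: ('n, 'k) mpoly set)"
    by (simp only: max_ideal_def image_image)
  have "p \<in> max_ideal \<longleftrightarrow> (\<forall>a\<in>Poly_Mapping.keys p. \<exists>i. Poly_Mapping.single i 1 mdvd a)"
    unfolding max_ideal_eq mem_span_mon_iff by blast
  also have "\<dots> \<longleftrightarrow> 0 \<notin> Poly_Mapping.keys p"
    unfolding iff by blast
  finally show ?thesis
    by (simp add: in_keys_iff)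
qed


section \<open>Simplicial chains\<close>

text \<open>The chains are functions on all sets of vertices, the empty set included, so the boundary below is
  that of the augmented chain complex. The coefficient ring is general because both the field and the
  polynomial ring occur.\<close>

definition vsign :: "'v rel \<Rightarrow> 'v \<Rightarrow> 'v set \<Rightarrow> 'c::comm_ring_1" where
  "vsign r v G = (-1) ^ card {w \<in> G. (w, v) \<in> r \<and> w \<noteq> v}"

definition boundary :: "'v set \<Rightarrow> 'v rel \<Rightarrow> ('v set \<Rightarrow> 'c::comm_ring_1) \<Rightarrow> 'v set \<Rightarrow> 'c" where
  "boundary V r c G = (\<Sum>v\<in>V - G. vsign r v G * c (insert v G))"

text \<open>The contraction of a full simplex onto its vertex \<open>u\<close>: it joins \<open>u\<close> to the faces that do not
  contain it and annihilates the others.\<close>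

definition cone :: "'v rel \<Rightarrow> 'v \<Rightarrow> ('v set \<Rightarrow> 'c::comm_ring_1) \<Rightarrow> 'v set \<Rightarrow> 'c" where
  "cone r u c F = (if u \<in> F then vsign r u (F - {u}) * c (F - {u}) else 0)"

lemma vsign_empty [simp]: "vsign r v {} = 1"
  by (simp add: vsign_def)

lemma vsign_square [simp]: "vsign r v G * vsign r v G = 1"
  by (simp add: vsign_def flip: power_mult_distrib)

lemma vsign_square_left [simp]: "vsign r v G * (vsign r v G * x) = x"
  by (simp flip: mult.assoc)

lemma vsign_insert:
  assumes "finite G" "w \<notin> G" "w \<noteq> v"
  shows "vsign r v (insert w G) = (if (w, v) \<in> r then - vsign r v G else vsign r v G)"
proof -
  have "{x \<in> insert w G. (x, v) \<in> r \<and> x \<noteq> v} = 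
      (if (w, v) \<in> r then insert w {x \<in> G. (x, v) \<in> r \<and> x \<noteq> v} else {x \<in> G. (x, v) \<in> r \<and> x \<noteq> v})"
    using assms(3) by auto
  then show ?thesis
    using assms(1,2) by (simp add: vsign_def)
qed

lemma linear_order_on_precedes_iff:
  assumes "linear_order_on V r" "u \<in> V" "v \<in> V" "u \<noteq> v"
  shows "(u, v) \<in> r \<longleftrightarrow> (v, u) \<notin> r"
  using assms unfolding linear_order_on_def partial_order_on_def
  by (metis antisymD total_on_def)

text \<open>Exactly one of two distinct vertices precedes the other, so exactly one of the two signs
  changes when the other vertex is added.\<close>

lemma vsign_swap:
  assumes "linear_order_on V r" "u \<in> V" "v \<in> V" "u \<noteq> v" "finite G" "u \<notin> G" "v \<notin> G"
  shows "vsign r v (insert u G) * vsign r u G = - (vsign r u (insert v G) * vsign r v G)"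
    and "vsign r v (insert u G) * vsign r u (insert v G) = - (vsign r v G * vsign r u G)"
proof -
  show "vsign r v (insert u G) * vsign r u G = - (vsign r u (insert v G) * vsign r v G)"
    "vsign r v (insert u G) * vsign r u (insert v G) = - (vsign r v G * vsign r u G)"
    using assms(4-7) linear_order_on_precedes_iff[OF assms(1-4)]
    by (auto simp: vsign_insert mult.commute)
qed

lemma boundary_diff: "boundary V r (\<lambda>F. c F - c' F) G = boundary V r c G - boundary V r c' G"
  by (simp add: boundary_def algebra_simps sum_subtractf)

text \<open>The contributions of adding \<open>v\<close> and then \<open>w\<close>, and of adding \<open>w\<close> and then \<open>v\<close>, cancel. Splitting the
  ordered pairs by \<open>r\<close> keeps the argument valid in characteristic two.\<close>

lemma boundary_boundary:
  assumes V: "finite V" "linear_order_on V r" and "finite G"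
  shows "boundary V r (boundary V r c) G = 0"
proof -
  define P where "P = {(v, w). v \<in> V - G \<and> w \<in> V - G \<and> (v, w) \<in> r \<and> v \<noteq> w}"
  define P' where "P' = {(v, w). v \<in> V - G \<and> w \<in> V - G \<and> (w, v) \<in> r \<and> v \<noteq> w}"
  define f where "f = (\<lambda>(v, w). vsign r v G * (vsign r w (insert v G) * c (insert w (insert v G))))"
  have fin: "finite P" "finite P'"
    by (rule finite_subset[OF _ finite_cartesian_product[OF V(1) V(1)]], auto simp: P_def P'_def)+
  note ord = linear_order_on_precedes_iff[OF V(2)]
  have "boundary V r (boundary V r c) G = sum f (SIGMA v:V - G. V - insert v G)"
    using V(1) by (simp add: boundary_def f_def sum_distrib_left sum.Sigma)
  also have "(SIGMA v:V - G. V - insert v G) = P \<union> P'"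
    unfolding P_def P'_def by (auto dest: ord)
  also have "sum f (P \<union> P') = sum f P + sum f P'"
    using fin by (intro sum.union_disjoint) (auto simp: P_def P'_def dest: ord)
  also have "sum f P' = (\<Sum>(v, w)\<in>P. f (w, v))"
    by (rule sum.reindex_bij_witness[of _ prod.swap prod.swap]) (auto simp: P_def P'_def)
  also have "\<dots> = (\<Sum>x\<in>P. - f x)"
  proof (rule sum.cong[OF refl], clarify)
    fix v w assume "(v, w) \<in> P"
    then have "vsign r v (insert w G) * vsign r w G = - (vsign r w (insert v G) * vsign r v G :: 'b)"
      using vsign_swap(1)[OF V(2), of w v G] assms(3) by (auto simp: P_def)
    then have "(vsign r v (insert w G) * vsign r w G) * c (insert v (insert w G))
        = - (vsign r w (insert v G) * vsign r v G) * c (insert v (insert w G))"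
      by (simp only:)
    then show "f (w, v) = - f (v, w)"
      by (simp add: f_def insert_commute[of w v] ac_simps)
  qed
  finally show ?thesis
    by (simp add: sum_negf)
qed

text \<open>The cone operator is a contracting homotopy of the full simplex. It is used twice: to fill a cycle
  by a chain on the full simplex, and to remove from such a chain the faces outside the Buchberger
  complex.\<close>

lemma boundary_cone:
  assumes V: "finite V" "linear_order_on V r" and u: "u \<in> V" and G: "finite G"
  shows "boundary V r (cone r u c) G = c G - cone r u (boundary V r c) G"
proof (cases "u \<in> G")
  case False
  have "boundary V r (cone r u c) G = (\<Sum>v\<in>V - G. if v = u then c G else 0)"
    unfolding boundary_def using False by (intro sum.cong) (auto simp: cone_def)
  also have "\<dots> = c G"
    using False u V(1) by (subst sum.delta) auto
  finally show ?thesis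
    using False by (simp add: cone_def)
next
  case True
  define H where "H = G - {u}"
  have H: "G = insert u H" "u \<notin> H" "finite H" "insert u H - {u} = H"
    using True G by (auto simp: H_def)
  have "cone r u (boundary V r c) G
      = vsign r u H * (\<Sum>v\<in>insert u (V - G). vsign r v H * c (insert v H))"
  proof -
    have "V - H = insert u (V - G)"
      using H u by auto
    then show ?thesis
      by (simp only: cone_def boundary_def True if_True H_def[symmetric])
  qed
  also have "\<dots> = c G + (\<Sum>v\<in>V - G. vsign r u H * (vsign r v H * c (insert v H)))"
    using V(1) H by (simp add: algebra_simps sum_distrib_left)
  finally have eq: "cone r u (boundary V r c) G = \<dots>" .
  have "boundary V r (cone r u c) G = (\<Sum>v\<in>V - G. - (vsign r u H * (vsign r v H * c (insert v H))))"
    unfolding boundary_def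
  proof (rule sum.cong[OF refl])
    fix v assume "v \<in> V - G"
    then have v: "v \<in> V" "v \<noteq> u" "v \<notin> H" "insert v (insert u H) - {u} = insert v H"
      using H by auto
    have "vsign r v G * cone r u c (insert v G)
        = (vsign r v (insert u H) * vsign r u (insert v H)) * c (insert v H)"
      by (simp only: H(1) v(4) cone_def mult.assoc insert_iff simp_thms if_True)
    also have "vsign r v (insert u H) * vsign r u (insert v H) = - (vsign r v H * vsign r u H :: 'b)"
      using vsign_swap(2)[OF V(2) u v(1)] v H by auto
    finally show "vsign r v G * cone r u c (insert v G) = - (vsign r u H * (vsign r v H * c (insert v H)))"
      by (simp add: ac_simps)
  qed
  then show ?thesis
    using eq by (simp add: sum_negf)
qed


section \<open>Acyclicity of the Buchberger complex below a multidegree\<close>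

text \<open>The Buchberger complex of an ideal depends on its minimal generators only, so its combinatorics needs
  neither the ideal nor the field.\<close>

definition buchberger_faces :: "'n::finite monom set \<Rightarrow> 'n monom set set" where
  "buchberger_faces V = {F. F \<subseteq> V \<and> \<not> (\<exists>u\<in>V. u pdvd mlcm F)}"

lemma buchberger_faces_subset:
  assumes "finite V" "F \<in> buchberger_faces V" "G \<subseteq> F"
  shows "G \<in> buchberger_faces V"
  using assms pdvd_mdvd_trans[OF _ mlcm_mono[OF _ assms(3)]]
  by (auto simp: buchberger_faces_def dest: finite_subset)

lemma buchberger_faces_D:
  assumes "F \<in> buchberger_faces V"
  shows "F \<subseteq> V" "u \<in> V \<Longrightarrow> \<not> u pdvd mlcm F"
  using assms by (auto simp: buchberger_faces_def)

text \<open>Let \<open>m\<close> have the proper divisor \<open>u\<close>. Adding or removing \<open>u\<close> does not change whether a face has label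
  \<open>m\<close>, so on the faces with label \<open>m\<close> the cone over \<open>u\<close> contracts the boundary operator up to faces
  with smaller labels. If no face outside the complex with a label strictly above \<open>m\<close> occurs in \<open>c\<close>,
  then the part of \<open>c\<close> with label \<open>m\<close> is a cycle modulo smaller labels, and subtracting the boundary
  of its cone removes it.\<close>

lemma remove_nonface_label:
  fixes c :: "'n::finite monom set \<Rightarrow> 'c::comm_ring_1"
  assumes V: "finite V" "linear_order_on V r" and u: "u \<in> V" "u pdvd m"
    and supp: "\<And>F. c F \<noteq> 0 \<Longrightarrow> F \<subseteq> V \<and> card F = n"
    and top: "\<And>F. c F \<noteq> 0 \<Longrightarrow> F \<notin> buchberger_faces V \<Longrightarrow> m mdvd mlcm F \<Longrightarrow> mlcm F = m"
    and bd: "\<And>G. G \<subseteq> V \<Longrightarrow> G \<notin> buchberger_faces V \<Longrightarrow> boundary V r c G = 0"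
  obtains c' where "\<And>G. G \<subseteq> V \<Longrightarrow> boundary V r c' G = boundary V r c G"
    and "\<And>F. c' F \<noteq> 0 \<Longrightarrow> F \<subseteq> V \<and> card F = n \<and> mlcm F \<noteq> m \<and>
           (c F \<noteq> 0 \<or> mlcm F mdvd m \<and> (\<exists>F'. c F' \<noteq> 0 \<and> mlcm F' = m))"
proof
  define cm where "cm F = (if mlcm F = m then c F else 0)" for F
  define c' where "c' F = c F - boundary V r (cone r u cm) F" for F
  have fin: "finite F" if "F \<subseteq> V" for F
    using V(1) that finite_subset by blast
  show "boundary V r c' G = boundary V r c G" if "G \<subseteq> V" for G
    unfolding c'_def boundary_diff using boundary_boundary[OF V fin[OF that]] by simp
  fix F assume F: "c' F \<noteq> 0"
  have FV: "F \<subseteq> V"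
  proof (rule ccontr)
    assume nsub: "\<not> F \<subseteq> V"
    have cm0: "cm G = 0" if "\<not> G \<subseteq> V" for G
      using supp[of G] that by (auto simp: cm_def)
    have "cone r u cm (insert v F) = 0" for v
    proof -
      have "\<not> insert v F - {u} \<subseteq> V"
        using nsub u(1) by blast
      then show ?thesis
        using cm0 by (simp add: cone_def)
    qed
    then have "boundary V r (cone r u cm) F = 0"
      by (simp add: boundary_def)
    then show False
      using F nsub supp by (auto simp: c'_def)
  qed
  \<comment> \<open>By the homotopy formula, the part with label \<open>m\<close> is traded for the cone over its boundary.\<close>
  have eq: "c' F = c F - cm F + cone r u (boundary V r cm) F"
    unfolding c'_def boundary_cone[OF V u(1) fin[OF FV]] by simp
  show "F \<subseteq> V \<and> card F = n \<and> mlcm F \<noteq> m \<and>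
           (c F \<noteq> 0 \<or> mlcm F mdvd m \<and> (\<exists>F'. c F' \<noteq> 0 \<and> mlcm F' = m))"
  proof (cases "cone r u (boundary V r cm) F = 0")
    case True
    then have "c F \<noteq> 0" "mlcm F \<noteq> m"
      using F eq by (auto simp: cm_def split: if_splits)
    then show ?thesis
      using supp by blast
  next
    case False
    define G where "G = F - {u}"
    have uF: "u \<in> F" and bdG: "boundary V r cm G \<noteq> 0"
      using False by (auto simp: cone_def G_def split: if_splits)
    have GV: "G \<subseteq> V"
      using FV by (auto simp: G_def)
    obtain v where v: "v \<in> V - G" "cm (insert v G) \<noteq> 0"
      using bdG unfolding boundary_def by (metis (no_types, lifting) mult_zero_right sum.neutral)
    have cv: "c (insert v G) \<noteq> 0" "mlcm (insert v G) = m"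
      using v(2) by (auto simp: cm_def split: if_splits)
    have "mlcm G mdvd m"
      using mlcm_mono[of "insert v G" G] fin[OF GV] cv(2) by auto
    then have Fm: "mlcm F mdvd m"
      using pdvd_imp_mdvd[OF u(2)] fin[OF FV] mlcm_mdvd_iff[of G m] mlcm_mdvd_iff[of F m] fin[OF GV]
      by (auto simp: G_def)
    have "card F = n"
      using supp[OF cv(1)] v(1) card_Suc_Diff1[OF fin[OF FV] uF] fin[OF GV] by (simp flip: G_def)
    moreover have "mlcm F \<noteq> m"
      \<comment> \<open>Otherwise \<open>G\<close> also has label \<open>m\<close>. The faces \<open>insert w G\<close> lie outside the complex, so those
          in \<open>c\<close> have label exactly \<open>m\<close>, and the boundary of \<open>cm\<close> at \<open>G\<close> is that of \<open>c\<close>, which vanishes.\<close>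
    proof
      assume "mlcm F = m"
      then have Gm: "mlcm G = m"
        using mlcm_remove_pdvd[OF fin[OF FV]] u(2) by (simp add: G_def)
      then have nonface: "insert w G \<notin> buchberger_faces V" if "w \<in> V" for w
        using u pdvd_mdvd_trans[OF u(2), of "mlcm (insert w G)"] mlcm_mono[of "insert w G" G]
          fin[OF GV] buchberger_faces_D(2)[of "insert w G" V u] by auto
      have "cm (insert w G) = c (insert w G)" if "w \<in> V" for w
        using top[of "insert w G", OF _ nonface[OF that]] mlcm_mono[of "insert w G" G] fin[OF GV] Gm
        by (auto simp: cm_def)
      then have "boundary V r cm G = boundary V r c G"
        by (simp add: boundary_def)
      moreover have "G \<notin> buchberger_faces V"
        using u Gm buchberger_faces_D(2)[of G V u] by auto
      ultimately show False
        using bd[OF GV] bdG by simp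
    qed
    ultimately show ?thesis
      using FV Fm cv by blast
  qed
qed

text \<open>The finite set \<open>L\<close> bounds the labels of the faces outside the complex. Removing a maximal label only
  creates faces with smaller labels, which lie in \<open>L\<close> because \<open>L\<close> is closed under divisors, so the
  process ends.\<close>

lemma push_into_buchberger_faces:
  fixes c :: "'n::finite monom set \<Rightarrow> 'c::comm_ring_1"
  assumes V: "finite V" "linear_order_on V r" and "finite L"
    and down: "\<And>m F. m \<in> L \<Longrightarrow> F \<subseteq> V \<Longrightarrow> mlcm F mdvd m \<Longrightarrow> mlcm F \<in> L"
    and supp: "\<And>F. c F \<noteq> 0 \<Longrightarrow> F \<subseteq> V \<and> card F = n \<and> mlcm F mdvd a"
    and L: "\<And>F. c F \<noteq> 0 \<Longrightarrow> F \<notin> buchberger_faces V \<Longrightarrow> mlcm F \<in> L"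
    and bd: "\<And>G. G \<subseteq> V \<Longrightarrow> G \<notin> buchberger_faces V \<Longrightarrow> boundary V r c G = 0"
  shows "\<exists>c'. (\<forall>F. c' F \<noteq> 0 \<longrightarrow> F \<in> buchberger_faces V \<and> card F = n \<and> mlcm F mdvd a) \<and>
              (\<forall>G\<subseteq>V. boundary V r c' G = boundary V r c G)"
  using assms(3-)
proof (induction L arbitrary: c rule: finite_psubset_induct)
  case (psubset L)
  show ?case
  proof (cases "L = {}")
    case True
    then show ?thesis
      using psubset.prems(2,3) by (intro exI[of _ c]) blast
  next
    case False
    then obtain m where m: "m \<in> L" "\<And>m'. m' \<in> L \<Longrightarrow> total_degree m' \<le> total_degree m"
      using obtains_MAX[OF psubset.hyps False, of total_degree] psubset.hyps
      by (metis Max_ge finite_imageI imageI)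
    have max: "m' = m" if "m' \<in> L" "m mdvd m'" for m'
      using m(2)[OF that(1)] total_degree_less[OF that(2)] by fastforce
    have down': "mlcm F \<in> L - {m}" if "m' \<in> L - {m}" "F \<subseteq> V" "mlcm F mdvd m'" for m' F
      using psubset.prems(1)[OF _ that(2,3)] max[of m'] that by blast
    have smaller: "L - {m} \<subset> L"
      using m(1) by blast
    show ?thesis
    proof (cases "\<exists>u\<in>V. u pdvd m")
      case False
      then have ne: "mlcm F \<noteq> m" if "c F \<noteq> 0" "F \<notin> buchberger_faces V" for F
        using that psubset.prems(2)[OF that(1)] by (auto simp: buchberger_faces_def)
      show ?thesis
      proof (rule psubset.IH[OF smaller])
        show "mlcm F \<in> L - {m}" if "c F \<noteq> 0" "F \<notin> buchberger_faces V" for F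
          using ne[OF that] psubset.prems(3)[OF that] by blast
      qed (rule down' psubset.prems; assumption)+
    next
      case True
      then obtain u where u: "u \<in> V" "u pdvd m" by blast
      obtain c' where bd': "\<And>G. G \<subseteq> V \<Longrightarrow> boundary V r c' G = boundary V r c G"
        and supp': "\<And>F. c' F \<noteq> 0 \<Longrightarrow> F \<subseteq> V \<and> card F = n \<and> mlcm F \<noteq> m \<and>
           (c F \<noteq> 0 \<or> mlcm F mdvd m \<and> (\<exists>F'. c F' \<noteq> 0 \<and> mlcm F' = m))"
      proof (rule remove_nonface_label[OF V u, of c n])
        show "mlcm F = m" if "c F \<noteq> 0" "F \<notin> buchberger_faces V" "m mdvd mlcm F" for F
          using psubset.prems(3)[OF that(1,2)] max that(3) by blast
      qed (use psubset.prems in blast)+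
      have 1: "F \<subseteq> V \<and> card F = n \<and> mlcm F mdvd a" if "c' F \<noteq> 0" for F
        using supp'[OF that] psubset.prems(2) mdvd_trans by metis
      have 2: "mlcm F \<in> L - {m}" if "c' F \<noteq> 0" "F \<notin> buchberger_faces V" for F
        using supp'[OF that(1)] that(2) psubset.prems(1)[OF m(1), of F] psubset.prems(3)[of F] by blast
      have 3: "boundary V r c' G = 0" if "G \<subseteq> V" "G \<notin> buchberger_faces V" for G
        using bd' psubset.prems(4) that by simp
      have "\<exists>c''. (\<forall>F. c'' F \<noteq> 0 \<longrightarrow> F \<in> buchberger_faces V \<and> card F = n \<and> mlcm F mdvd a) \<and>
          (\<forall>G\<subseteq>V. boundary V r c'' G = boundary V r c' G)"
        by (rule psubset.IH[OF smaller]) (rule down' 1 2 3; assumption)+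
      then show ?thesis
        using bd' by simp
    qed
  qed
qed

text \<open>A cycle is filled on the full simplex by the cone over a generator dividing \<open>a\<close>; the filling is then
  pushed into the Buchberger complex without changing its boundary. For \<open>n = 0\<close> the cycle is a multiple
  of the empty face.\<close>

lemma buchberger_faces_acyclic:
  fixes c :: "'n::finite monom set \<Rightarrow> 'c::comm_ring_1"
  assumes V: "finite V" "linear_order_on V r" and u: "u \<in> V" "u mdvd a"
    and supp: "\<And>F. c F \<noteq> 0 \<Longrightarrow> F \<in> buchberger_faces V \<and> card F = n \<and> mlcm F mdvd a"
    and cycle: "\<And>G. G \<subseteq> V \<Longrightarrow> boundary V r c G = 0"
  shows "\<exists>w. (\<forall>F. w F \<noteq> 0 \<longrightarrow> F \<in> buchberger_faces V \<and> card F = Suc n \<and> mlcm F mdvd a) \<and>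
             (\<forall>G\<subseteq>V. boundary V r w G = c G)"
proof -
  have fin: "finite F" if "F \<subseteq> V" for F
    using V(1) that finite_subset by blast
  have bd: "boundary V r (cone r u c) G = c G" if "G \<subseteq> V" for G
  proof -
    have "boundary V r c (G - {u}) = 0"
      using cycle that by blast
    then show ?thesis
      unfolding boundary_cone[OF V u(1) fin[OF that]] by (simp add: cone_def)
  qed
  have supp': "F \<subseteq> V \<and> card F = Suc n \<and> mlcm F mdvd a" if "cone r u c F \<noteq> 0" for F
  proof -
    have F: "u \<in> F" "c (F - {u}) \<noteq> 0"
      using that by (auto simp: cone_def split: if_splits)
    then have face: "F - {u} \<subseteq> V" "card (F - {u}) = n" "mlcm (F - {u}) mdvd a"
      using supp buchberger_faces_D(1) by blast+
    then have FV: "F \<subseteq> V"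
      using u(1) by blast
    then have "mlcm F mdvd a"
      using face(3) u(2) fin mlcm_mdvd_iff[of F a] mlcm_mdvd_iff[of "F - {u}" a] by auto
    then show ?thesis
      using FV face(2) F(1) fin[OF FV] card_Suc_Diff1[of F u] by simp
  qed
  define L where "L = {mlcm F | F. F \<subseteq> V \<and> mlcm F mdvd a}"
  have "L \<subseteq> mlcm ` Pow V"
    by (auto simp: L_def)
  then have "finite L"
    using V(1) by (meson finite_Pow_iff finite_imageI finite_subset)
  then have "\<exists>w. (\<forall>F. w F \<noteq> 0 \<longrightarrow> F \<in> buchberger_faces V \<and> card F = Suc n \<and> mlcm F mdvd a) \<and>
             (\<forall>G\<subseteq>V. boundary V r w G = boundary V r (cone r u c) G)"
  proof (rule push_into_buchberger_faces[OF V])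
    show "mlcm F \<in> L" if "m \<in> L" "F \<subseteq> V" "mlcm F mdvd m" for m F
      using that mdvd_trans by (fastforce simp: L_def)
    show "mlcm F \<in> L" if "cone r u c F \<noteq> 0" "F \<notin> buchberger_faces V" for F
      using supp'[OF that(1)] by (auto simp: L_def)
    show "boundary V r (cone r u c) G = 0" if "G \<subseteq> V" "G \<notin> buchberger_faces V" for G
      using bd[OF that(1)] that(2) supp by auto
  qed (use supp' in blast)
  then show ?thesis
    using bd by simp
qed


section \<open>Dehomogenization\<close>

lemma mon_mult: "mon u * mon v = mon (u + v)"
  by (simp add: mon_def mult_single)

lemma times_mon_cancel: "p * mon m = q * mon m \<longleftrightarrow> p = q"
proof
  assume eq: "p * mon m = q * mon m"
  show "p = q"
  proof (rule poly_mapping_eqI)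
    fix a
    show "Poly_Mapping.lookup p a = Poly_Mapping.lookup q a"
      using arg_cong[OF eq, of "\<lambda>x. Poly_Mapping.lookup x (a + m)"] by (simp add: lookup_times_mon)
  qed
qed simp

text \<open>The embedding of the homogenized complex into the simplicial chains with polynomial coefficients,
  \<open>e\<^sub>F \<mapsto> m\<^sub>F F\<close>. It is injective, its image consists of the chains whose coefficient at \<open>F\<close> is divisible
  by \<open>m\<^sub>F\<close>, and it turns the differential and the augmentation into the simplicial boundary, without
  monomial factors.\<close>

definition dehomogenize :: "('n::finite monom set \<Rightarrow>\<^sub>0 ('n, 'k::field) mpoly) \<Rightarrow> 'n monom set \<Rightarrow> ('n, 'k) mpoly" where
  "dehomogenize z F = Poly_Mapping.lookup z F * mon (mlcm F)"

lemma dehomogenize_0 [simp]: "dehomogenize 0 F = 0"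
  by (simp add: dehomogenize_def)

lemma dehomogenize_eq_0_iff: "dehomogenize z F = 0 \<longleftrightarrow> Poly_Mapping.lookup z F = 0"
  using times_mon_cancel[of "Poly_Mapping.lookup z F" "mlcm F" 0] by (simp add: dehomogenize_def)

lemma dehomogenize_eqI:
  assumes "\<And>F. dehomogenize z F = dehomogenize z' F"
  shows "z = z'"
  using assms by (intro poly_mapping_eqI) (simp add: dehomogenize_def times_mon_cancel)

lemma keys_dehomogenize: "a \<in> Poly_Mapping.keys (dehomogenize z F) \<Longrightarrow> mlcm F mdvd a"
  by (auto simp: dehomogenize_def in_keys_iff lookup_times_mon split: if_splits)

lemma ex_dehomogenize:
  fixes C :: "'n::finite monom set \<Rightarrow> ('n, 'k::field) mpoly"
  assumes "finite B" and C: "\<And>F. C F \<noteq> 0 \<Longrightarrow> F \<in> B"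
    and dvd: "\<And>F a. a \<in> Poly_Mapping.keys (C F) \<Longrightarrow> mlcm F mdvd a"
  obtains z where "z \<in> free_mod B" "\<And>F. dehomogenize z F = C F"
proof -
  define q where "q F = (\<Sum>a\<in>Poly_Mapping.keys (C F).
    Poly_Mapping.single (a - mlcm F) (Poly_Mapping.lookup (C F) a))" for F
  have q: "q F * mon (mlcm F) = C F" for F
  proof -
    have "q F * mon (mlcm F) = (\<Sum>a\<in>Poly_Mapping.keys (C F). Poly_Mapping.single a (Poly_Mapping.lookup (C F) a))"
      unfolding q_def sum_distrib_right
      by (rule sum.cong) (simp_all add: mon_def mult_single mdvd_diff_add dvd)
    then show ?thesis
      by (simp only: sum_single_lookup)
  qed
  define z where "z = (\<Sum>F\<in>B. Poly_Mapping.single F (q F))"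
  have lookup_z: "Poly_Mapping.lookup z F = (if F \<in> B then q F else 0)" for F
    using assms(1) by (simp add: z_def lookup_sum lookup_single when_def)
  show thesis
  proof
    show "z \<in> free_mod B"
      by (auto simp: free_mod_def in_keys_iff lookup_z split: if_splits)
    show "dehomogenize z F = C F" for F
      using q C by (auto simp: dehomogenize_def lookup_z)
  qed
qed

text \<open>Summing over a fixed finite set instead of the support makes the linearity of the differential
  visible.\<close>

lemma bd_eq_sum_superset:
  assumes "finite B" "Poly_Mapping.keys x \<subseteq> B"
  shows "bd r i x = (if i = 0 then 0 else \<Sum>F\<in>B. smult (Poly_Mapping.lookup x F) (bd_basis r F))"
  using assms unfolding bd_def
  by (intro if_cong sum.mono_neutral_left) (auto simp: in_keys_iff)

lemma module_hom_bd:
  "module_hom smult smult (bd r i :: ('n::finite monom set \<Rightarrow>\<^sub>0 ('n, 'k::field) mpoly) \<Rightarrow> _)"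
proof -
  have add: "bd r i (x + y) = bd r i x + bd r i y" for x y :: "'n monom set \<Rightarrow>\<^sub>0 ('n, 'k) mpoly"
  proof -
    let ?B = "Poly_Mapping.keys x \<union> Poly_Mapping.keys y"
    have "finite ?B" "Poly_Mapping.keys (x + y) \<subseteq> ?B" "Poly_Mapping.keys x \<subseteq> ?B" "Poly_Mapping.keys y \<subseteq> ?B"
      using keys_add[of x y] by auto
    then show ?thesis
      by (simp add: bd_eq_sum_superset[of ?B] lookup_add fmod.scale_left_distrib sum.distrib)
  qed
  have scale: "bd r i (smult p x) = smult p (bd r i x)" for p and x :: "'n monom set \<Rightarrow>\<^sub>0 ('n, 'k) mpoly"
  proof -
    have "Poly_Mapping.keys (smult p x) \<subseteq> Poly_Mapping.keys x"
      by (auto simp: in_keys_iff)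
    then show ?thesis
      by (simp add: bd_eq_sum_superset[of "Poly_Mapping.keys x"] fmod.scale_sum_right)
  qed
  show ?thesis
    using add scale by (simp add: module_hom_iff fmod.module_axioms)
qed

lemma module_hom_aug: 
  "module_hom smult (*) (aug :: ('n::finite monom set \<Rightarrow>\<^sub>0 ('n, 'k::field) mpoly) \<Rightarrow> _)"
proof -
  have superset: "aug x = (\<Sum>F\<in>B. Poly_Mapping.lookup x F * mon (mlcm F))"
    if "finite B" "Poly_Mapping.keys x \<subseteq> B" for x :: "'n monom set \<Rightarrow>\<^sub>0 ('n, 'k) mpoly" and B
    unfolding aug_def using that by (intro sum.mono_neutral_left) (auto simp: in_keys_iff)
  have add: "aug (x + y) = aug x + aug y" for x y :: "'n monom set \<Rightarrow>\<^sub>0 ('n, 'k) mpoly"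
  proof -
    let ?B = "Poly_Mapping.keys x \<union> Poly_Mapping.keys y"
    have "finite ?B" "Poly_Mapping.keys (x + y) \<subseteq> ?B" "Poly_Mapping.keys x \<subseteq> ?B" "Poly_Mapping.keys y \<subseteq> ?B"
      using keys_add[of x y] by auto
    then show ?thesis
      by (simp add: superset[of ?B] lookup_add distrib_right sum.distrib)
  qed
  have scale: "aug (smult p x) = p * aug x" for p and x :: "'n monom set \<Rightarrow>\<^sub>0 ('n, 'k) mpoly"
  proof -
    have "aug (smult p x) = (\<Sum>F\<in>Poly_Mapping.keys x. Poly_Mapping.lookup (smult p x) F * mon (mlcm F))"
      by (rule superset) (auto simp: in_keys_iff)
    then show ?thesis
      by (simp add: aug_def sum_distrib_left)
  qed
  show ?thesis
    using add scale by (simp add: module_hom_iff fmod.module_axioms poly.module_axioms)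
qed

lemma lookup_bd_basis_times_mon:
  assumes V: "finite V" "F \<subseteq> V"
  shows "Poly_Mapping.lookup (bd_basis r F) G * mon (mlcm G)
    = (\<Sum>v\<in>V - G. if F = insert v G then vsign r v G * mon (mlcm F) else 0)"
proof -
  have "Poly_Mapping.lookup (bd_basis r F) G * mon (mlcm G)
      = (\<Sum>v\<in>F. if F - {v} = G then vsign r v G * mon (mlcm F) else 0)"
    unfolding bd_basis_def lookup_sum sum_distrib_right
  proof (rule sum.cong[OF refl])
    fix v assume v: "v \<in> F"
    show "Poly_Mapping.lookup (Poly_Mapping.single (F - {v})
        ((- 1) ^ card {w \<in> F. (w, v) \<in> r \<and> w \<noteq> v} * mon (mlcm F - mlcm (F - {v})))) G * mon (mlcm G)
      = (if F - {v} = G then vsign r v G * mon (mlcm F) else 0)"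
    proof (cases "F - {v} = G")
      case True
      have "{w \<in> F. (w, v) \<in> r \<and> w \<noteq> v} = {w \<in> G. (w, v) \<in> r \<and> w \<noteq> v}"
        using True by blast
      moreover have "mlcm G mdvd mlcm F"
        using True V finite_subset by (intro mlcm_mono) auto
      ultimately show ?thesis
        using True by (simp add: vsign_def mult.assoc mon_mult mdvd_diff_add del: poly.scale_scale)
    qed (simp add: lookup_single)
  qed
  also have "\<dots> = (\<Sum>v\<in>V - G. if F = insert v G then vsign r v G * mon (mlcm F) else 0)"
    using V finite_subset by (intro sum.mono_neutral_cong) auto
  finally show ?thesis .
qed

text \<open>The factor \<open>m\<^sub>F / m\<^sub>G\<close> of the differential and the factor \<open>m\<^sub>G\<close> of the embedding multiply to \<open>m\<^sub>F\<close>,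
  which belongs to the coefficient at \<open>F\<close> already.\<close>

lemma dehomogenize_bd:
  assumes V: "finite V" "Poly_Mapping.keys z \<subseteq> Pow V" and "i \<noteq> 0"
  shows "dehomogenize (bd r i z) G = boundary V r (dehomogenize z) G"
proof -
  have "dehomogenize (bd r i z) G = (\<Sum>F\<in>Poly_Mapping.keys z.
      Poly_Mapping.lookup z F * (Poly_Mapping.lookup (bd_basis r F) G * mon (mlcm G)))"
    using assms(3) by (simp add: dehomogenize_def bd_def lookup_sum sum_distrib_right)
  also have "\<dots> = (\<Sum>F\<in>Poly_Mapping.keys z. \<Sum>v\<in>V - G.
      if F = insert v G then vsign r v G * dehomogenize z F else 0)"
  proof (rule sum.cong[OF refl])
    fix F assume "F \<in> Poly_Mapping.keys z"
    then have "F \<subseteq> V" using V(2) by blast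
    show "Poly_Mapping.lookup z F * (Poly_Mapping.lookup (bd_basis r F) G * mon (mlcm G))
        = (\<Sum>v\<in>V - G. if F = insert v G then vsign r v G * dehomogenize z F else 0)"
      unfolding lookup_bd_basis_times_mon[OF V(1) \<open>F \<subseteq> V\<close>] sum_distrib_left
      by (rule sum.cong) (simp_all add: dehomogenize_def ac_simps del: poly.scale_scale)
  qed
  also have "\<dots> = (\<Sum>v\<in>V - G. \<Sum>F\<in>Poly_Mapping.keys z.
      if F = insert v G then vsign r v G * dehomogenize z F else 0)"
    by (rule sum.swap)
  also have "\<dots> = boundary V r (dehomogenize z) G"
    unfolding boundary_def
    by (rule sum.cong) (auto simp: in_keys_iff dehomogenize_def)
  finally show ?thesis .
qed

lemma mem_free_mod_iff: "z \<in> free_mod B \<longleftrightarrow> (\<forall>F. Poly_Mapping.lookup z F \<noteq> 0 \<longrightarrow> F \<in> B)"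
  by (auto simp: free_mod_def in_keys_iff)

lemma faces_buchberger:
  assumes "finite V"
  shows "faces (buchberger_faces V) i = {F \<in> buchberger_faces V. card F = Suc i}"
  using assms finite_subset by (auto simp: faces_def buchberger_faces_def)

lemma finite_faces_buchberger: "finite V \<Longrightarrow> finite (faces (buchberger_faces V) i)"
  by (rule finite_subset[of _ "Pow V"]) (auto simp: faces_def buchberger_faces_def)

lemma keys_faces_buchberger:
  "z \<in> free_mod (faces (buchberger_faces V) i) \<Longrightarrow> Poly_Mapping.keys z \<subseteq> Pow V"
  by (auto simp: free_mod_def faces_def buchberger_faces_def)

lemma bd_mem_free_mod:
  assumes V: "finite V" and z: "z \<in> free_mod (faces (buchberger_faces V) (Suc i))"
  shows "bd r (Suc i) z \<in> free_mod (faces (buchberger_faces V) i)"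
  unfolding mem_free_mod_iff
proof (intro allI impI)
  fix G assume "Poly_Mapping.lookup (bd r (Suc i) z) G \<noteq> 0"
  then have "boundary V r (dehomogenize z) G \<noteq> 0"
    using dehomogenize_bd[OF V keys_faces_buchberger[OF z]] dehomogenize_eq_0_iff by (metis nat.simps(3))
  then obtain v where v: "v \<in> V - G" "dehomogenize z (insert v G) \<noteq> 0"
    unfolding boundary_def by (metis (no_types, lifting) mult_zero_right sum.neutral)
  then have face: "insert v G \<in> buchberger_faces V" "card (insert v G) = Suc (Suc i)"
    using z V by (auto simp: dehomogenize_eq_0_iff mem_free_mod_iff faces_buchberger)
  then have "finite G"
    using card_gt_0_iff by fastforce
  then show "G \<in> faces (buchberger_faces V) i"
    using face v(1) buchberger_faces_subset[OF V face(1), of G] V by (auto simp: faces_buchberger)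
qed

text \<open>The augmentation is the missing differential, from the vertices to the empty face.\<close>

lemma aug_eq_boundary:
  assumes V: "finite V" and z: "z \<in> free_mod (faces (buchberger_faces V) 0)"
  shows "aug z = boundary V r (dehomogenize z) {}"
proof -
  have "F \<in> (\<lambda>v. {v}) ` V" if "F \<in> Poly_Mapping.keys z" for F
  proof -
    have "F \<in> faces (buchberger_faces V) 0"
      using that z by (auto simp: free_mod_def)
    then have "F \<subseteq> V" "card F = 1"
      by (auto simp: faces_buchberger[OF V] dest: buchberger_faces_D(1))
    then show ?thesis
      by (auto simp: card_1_singleton_iff)
  qed
  then have "aug z = (\<Sum>F\<in>(\<lambda>v. {v}) ` V. dehomogenize z F)"
    unfolding aug_def dehomogenize_def using V
    by (intro sum.mono_neutral_left) (auto simp: in_keys_iff)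
  also have "\<dots> = boundary V r (dehomogenize z) {}"
    by (simp add: boundary_def sum.reindex)
  finally show ?thesis .
qed

lemma lookup_vsign_times:
  fixes p :: "('n, 'k::field) mpoly"
  shows "Poly_Mapping.lookup (vsign r v G * p) a = vsign r v G * Poly_Mapping.lookup p a"
  by (cases "even (card {w \<in> G. (w, v) \<in> r \<and> w \<noteq> v})") (simp_all add: vsign_def)

lemma lookup_boundary:
  fixes C :: "'v set \<Rightarrow> ('n, 'k::field) mpoly"
  shows "Poly_Mapping.lookup (boundary V r C G) a = boundary V r (\<lambda>F. Poly_Mapping.lookup (C F) a) G"
  by (simp add: boundary_def lookup_sum lookup_vsign_times)

lemma eq_single_iff: "(\<exists>c. p = Poly_Mapping.single a c) \<longleftrightarrow> (\<forall>b. b \<noteq> a \<longrightarrow> Poly_Mapping.lookup p b = 0)"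
proof
  assume "\<forall>b. b \<noteq> a \<longrightarrow> Poly_Mapping.lookup p b = 0"
  then have "p = Poly_Mapping.single a (Poly_Mapping.lookup p a)"
    by (intro poly_mapping_eqI) (simp add: lookup_single when_def)
  then show "\<exists>c. p = Poly_Mapping.single a c" ..
qed (auto simp: lookup_single)

text \<open>After the embedding, every coefficient of an element of multidegree \<open>a\<close> is a multiple of the same
  monomial, and the boundary forms signed sums of these coefficients.\<close>

lemma homogeneous_boundary:
  assumes "homogeneous mlcm a z"
  shows "\<exists>c. boundary V r (dehomogenize z) G = Poly_Mapping.single a c"
proof -
  have "Poly_Mapping.lookup (dehomogenize z F) b = 0" if "b \<noteq> a" for b F
    using assms that unfolding homogeneous_def dehomogenize_def eq_single_iff by blast
  then show ?thesis
    unfolding eq_single_iff lookup_boundary by (simp add: boundary_def)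
qed

text \<open>The boundary acts on the coefficients of each monomial \<open>a\<close> separately, so the chain can be filled one
  multidegree at a time. Divisibility of the coefficient at \<open>F\<close> by \<open>m\<^sub>F\<close> becomes the condition that only
  faces with label dividing \<open>a\<close> are used.\<close>

lemma ex_boundary_eq:
  fixes C :: "'n::finite monom set \<Rightarrow> ('n, 'k::field) mpoly"
  assumes V: "finite V" "linear_order_on V r"
    and C: "\<And>F. C F \<noteq> 0 \<Longrightarrow> F \<in> buchberger_faces V \<and> card F = n"
    and dvd: "\<And>F a. a \<in> Poly_Mapping.keys (C F) \<Longrightarrow> mlcm F mdvd a \<and> (\<exists>u\<in>V. u mdvd a)"
    and cycle: "\<And>G. G \<subseteq> V \<Longrightarrow> boundary V r C G = 0"
  obtains z where "z \<in> free_mod (faces (buchberger_faces V) n)"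
    and "\<And>G. G \<subseteq> V \<Longrightarrow> boundary V r (dehomogenize z) G = C G"
proof -
  define A where "A = (\<Union>F\<in>Pow V. Poly_Mapping.keys (C F))"
  have "finite A"
    using V(1) by (simp add: A_def)
  have "\<exists>w. (\<forall>F. w F \<noteq> 0 \<longrightarrow> F \<in> buchberger_faces V \<and> card F = Suc n \<and> mlcm F mdvd a) \<and>
             (\<forall>G\<subseteq>V. boundary V r w G = Poly_Mapping.lookup (C G) a)" if a: "a \<in> A" for a
  proof -
    obtain u where u: "u \<in> V" "u mdvd a"
      using a dvd unfolding A_def by blast
    show ?thesis
    proof (rule buchberger_faces_acyclic[OF V u])
      show "F \<in> buchberger_faces V \<and> card F = n \<and> mlcm F mdvd a" if "Poly_Mapping.lookup (C F) a \<noteq> 0" for F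
      proof -
        have "C F \<noteq> 0" "a \<in> Poly_Mapping.keys (C F)"
          using that by (auto simp: in_keys_iff)
        then show ?thesis
          using C dvd by blast
      qed
      show "boundary V r (\<lambda>F. Poly_Mapping.lookup (C F) a) G = 0" if "G \<subseteq> V" for G
        using cycle[OF that] by (simp flip: lookup_boundary)
    qed
  qed
  then obtain w where w: "\<And>a F. a \<in> A \<Longrightarrow> w a F \<noteq> 0 \<Longrightarrow> F \<in> buchberger_faces V \<and> card F = Suc n \<and> mlcm F mdvd a"
      and bd_w: "\<And>a G. a \<in> A \<Longrightarrow> G \<subseteq> V \<Longrightarrow> boundary V r (w a) G = Poly_Mapping.lookup (C G) a"
    by metis
  define W where "W F = (\<Sum>a\<in>A. Poly_Mapping.single a (w a F))" for F
  have lookup_W: "Poly_Mapping.lookup (W F) a = (if a \<in> A then w a F else 0)" for F a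
    using \<open>finite A\<close> by (simp add: W_def lookup_sum lookup_single when_def)
  have "F \<in> faces (buchberger_faces V) n" if F: "W F \<noteq> 0" for F
  proof -
    obtain a where "Poly_Mapping.lookup (W F) a \<noteq> 0"
      using F by (metis lookup_zero poly_mapping_eqI)
    then show ?thesis
      using w V(1) by (auto simp: lookup_W faces_buchberger split: if_splits)
  qed
  moreover have "mlcm F mdvd a" if "a \<in> Poly_Mapping.keys (W F)" for F a
    using that w by (auto simp: in_keys_iff lookup_W split: if_splits)
  ultimately obtain z where z: "z \<in> free_mod (faces (buchberger_faces V) n)" "\<And>F. dehomogenize z F = W F"
    using ex_dehomogenize[OF finite_faces_buchberger[OF V(1)], of W n] by blast
  show thesis
  proof
    fix G assume G: "G \<subseteq> V"
    have "Poly_Mapping.lookup (boundary V r W G) a = Poly_Mapping.lookup (C G) a" for a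
    proof (cases "a \<in> A")
      case True
      then show ?thesis
        using bd_w[OF True G] by (simp add: lookup_boundary lookup_W)
    next
      case False
      then have "Poly_Mapping.lookup (C G) a = 0"
        using G by (auto simp: A_def in_keys_iff)
      then show ?thesis
        using False unfolding lookup_boundary by (simp add: lookup_W boundary_def)
    qed
    moreover have "dehomogenize z = W"
      using z(2) by blast
    ultimately show "boundary V r (dehomogenize z) G = C G"
      by (simp add: poly_mapping_eqI)
  qed (use z in blast)
qed


section \<open>Exactness and minimality\<close>

text \<open>Since the faces of the cycle are nonempty, any vertex of such a face is a generator dividing the
  monomials in its coefficient, as needed for filling.\<close>

lemma ex_bd_eq:
  assumes V: "finite V" "linear_order_on V r"
    and z: "z \<in> free_mod (faces (buchberger_faces V) i)"
    and cycle: "\<And>G. G \<subseteq> V \<Longrightarrow> boundary V r (dehomogenize z) G = 0"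
  shows "\<exists>z'\<in>free_mod (faces (buchberger_faces V) (Suc i)). bd r (Suc i) z' = z"
proof -
  have face: "F \<in> buchberger_faces V \<and> card F = Suc i" if "dehomogenize z F \<noteq> 0" for F
    using that z V(1) by (auto simp: dehomogenize_eq_0_iff mem_free_mod_iff faces_buchberger)
  have dvd: "mlcm F mdvd a \<and> (\<exists>u\<in>V. u mdvd a)" if "a \<in> Poly_Mapping.keys (dehomogenize z F)" for F a
  proof -
    have "dehomogenize z F \<noteq> 0" using that by auto
    then have F: "F \<subseteq> V" "card F = Suc i"
      using face buchberger_faces_D(1) by blast+
    then obtain u where u: "u \<in> F" by (metis all_not_in_conv card.empty nat.simps(3))
    have "finite F" using F(2) card_gt_0_iff by fastforce
    then show ?thesis
      using u F(1) keys_dehomogenize[OF that] mlcm_mdvd_iff by blast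
  qed
  obtain z' where z': "z' \<in> free_mod (faces (buchberger_faces V) (Suc i))"
      and bd_z': "\<And>G. G \<subseteq> V \<Longrightarrow> boundary V r (dehomogenize z') G = dehomogenize z G"
    using ex_boundary_eq[OF V face dvd cycle] by blast
  have "bd r (Suc i) z' = z"
  proof (rule dehomogenize_eqI)
    fix G
    show "dehomogenize (bd r (Suc i) z') G = dehomogenize z G"
    proof (cases "G \<subseteq> V")
      case True
      then show ?thesis
        using bd_z' dehomogenize_bd[OF V(1) keys_faces_buchberger[OF z']] by simp
    next
      case False
      then have "G \<notin> faces (buchberger_faces V) i"
        by (auto simp: faces_def buchberger_faces_def)
      then show ?thesis
        using z bd_mem_free_mod[OF V(1) z', of r]
        by (metis dehomogenize_eq_0_iff mem_free_mod_iff)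
    qed
  qed
  then show ?thesis using z' by blast
qed

lemma image_bd_buchberger:
  assumes V: "finite V" "linear_order_on V r"
  shows "bd r (Suc (Suc i)) ` free_mod (faces (buchberger_faces V) (Suc (Suc i)))
    = {z \<in> free_mod (faces (buchberger_faces V) (Suc i)). bd r (Suc i) z = 0}"
proof (intro equalityI subsetI)
  fix y assume "y \<in> bd r (Suc (Suc i)) ` free_mod (faces (buchberger_faces V) (Suc (Suc i)))"
  then obtain z where z: "z \<in> free_mod (faces (buchberger_faces V) (Suc (Suc i)))"
      and y: "y = bd r (Suc (Suc i)) z" by blast
  have y': "y \<in> free_mod (faces (buchberger_faces V) (Suc i))"
    unfolding y by (rule bd_mem_free_mod[OF V(1) z])
  have eq: "dehomogenize y = boundary V r (dehomogenize z)"
    unfolding y using dehomogenize_bd[OF V(1) keys_faces_buchberger[OF z]] by auto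
  have "bd r (Suc i) y = 0"
  proof (rule dehomogenize_eqI)
    fix G
    show "dehomogenize (bd r (Suc i) y) G = dehomogenize 0 G"
    proof (cases "finite G")
      case True
      then show ?thesis
        using dehomogenize_bd[OF V(1) keys_faces_buchberger[OF y']] boundary_boundary[OF V True]
        by (simp add: eq dehomogenize_def)
    next
      case False
      then have "G \<notin> faces (buchberger_faces V) i"
        by (auto simp: faces_def)
      then show ?thesis
        using bd_mem_free_mod[OF V(1) y', of r]
        by (metis dehomogenize_eq_0_iff lookup_zero mem_free_mod_iff)
    qed
  qed
  then show "y \<in> {z \<in> free_mod (faces (buchberger_faces V) (Suc i)). bd r (Suc i) z = 0}"
    using y' by blast
next
  fix z assume "z \<in> {z \<in> free_mod (faces (buchberger_faces V) (Suc i)). bd r (Suc i) z = 0}"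
  then have z: "z \<in> free_mod (faces (buchberger_faces V) (Suc i))" "bd r (Suc i) z = 0" by auto
  have "boundary V r (dehomogenize z) G = 0" for G
    using dehomogenize_bd[OF V(1) keys_faces_buchberger[OF z(1)], of "Suc i" r G] z(2) by simp
  then show "z \<in> bd r (Suc (Suc i)) ` free_mod (faces (buchberger_faces V) (Suc (Suc i)))"
    using ex_bd_eq[OF V z(1)] by (metis image_eqI)
qed

lemma image_bd_1_buchberger:
  assumes V: "finite V" "linear_order_on V r"
  shows "bd r 1 ` free_mod (faces (buchberger_faces V) 1)
    = {z \<in> free_mod (faces (buchberger_faces V) 0). aug z = 0}"
proof (intro equalityI subsetI)
  fix y assume "y \<in> bd r 1 ` free_mod (faces (buchberger_faces V) 1)"
  then obtain z where z: "z \<in> free_mod (faces (buchberger_faces V) (Suc 0))"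
      and y: "y = bd r (Suc 0) z" by auto
  have y': "y \<in> free_mod (faces (buchberger_faces V) 0)"
    unfolding y by (rule bd_mem_free_mod[OF V(1) z])
  have "dehomogenize y = boundary V r (dehomogenize z)"
    unfolding y using dehomogenize_bd[OF V(1) keys_faces_buchberger[OF z]] by auto
  then have "aug y = 0"
    using aug_eq_boundary[OF V(1) y', of r] boundary_boundary[OF V, of "{}"] by simp
  then show "y \<in> {z \<in> free_mod (faces (buchberger_faces V) 0). aug z = 0}"
    using y' by blast
next
  fix z assume "z \<in> {z \<in> free_mod (faces (buchberger_faces V) 0). aug z = 0}"
  then have z: "z \<in> free_mod (faces (buchberger_faces V) 0)" "aug z = 0" by auto
  have "boundary V r (dehomogenize z) G = 0" if "G \<subseteq> V" for G
  proof (cases "G = {}")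
    case True
    then show ?thesis
      using aug_eq_boundary[OF V(1) z(1)] z(2) by simp
  next
    case False
    have "dehomogenize z (insert v G) = 0" if "v \<in> V - G" for v
    proof -
      have "card (insert v G) \<noteq> Suc 0"
        using False that by (auto simp: card_1_singleton_iff)
      then show ?thesis
        using z(1) V(1) by (auto simp: dehomogenize_eq_0_iff mem_free_mod_iff faces_buchberger)
    qed
    then show ?thesis
      by (simp add: boundary_def)
  qed
  then show "z \<in> bd r 1 ` free_mod (faces (buchberger_faces V) 1)"
    using ex_bd_eq[OF V z(1)] by (metis One_nat_def image_eqI)
qed

text \<open>Surjectivity is exactness at the empty face, which belongs to the complex because only the monomial
  \<open>1\<close> properly divides \<open>1\<close>, and it is not a generator.\<close>

lemma image_aug_buchberger:
  fixes V :: "'n::finite monom set"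
  assumes V: "finite V" "linear_order_on V r" and "0 \<notin> V"
  shows "aug ` free_mod (faces (buchberger_faces V) 0)
    = {p :: ('n, 'k::field) mpoly. \<forall>a\<in>Poly_Mapping.keys p. \<exists>u\<in>V. u mdvd a}"
proof (intro equalityI subsetI)
  fix p :: "('n, 'k) mpoly" assume "p \<in> aug ` free_mod (faces (buchberger_faces V) 0)"
  then obtain z where z: "z \<in> free_mod (faces (buchberger_faces V) 0)" and p: "p = aug z" by blast
  have "\<exists>u\<in>V. u mdvd a" if "a \<in> Poly_Mapping.keys p" for a
  proof -
    have "(\<Sum>v\<in>V. Poly_Mapping.lookup (dehomogenize z {v}) a) \<noteq> 0"
      using that aug_eq_boundary[OF V(1) z, of r]
      by (simp add: p in_keys_iff boundary_def lookup_sum)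
    then obtain v where "v \<in> V" "a \<in> Poly_Mapping.keys (dehomogenize z {v})"
      by (auto simp: in_keys_iff elim: sum.not_neutral_contains_not_neutral)
    then show ?thesis
      using keys_dehomogenize by fastforce
  qed
  then show "p \<in> {p. \<forall>a\<in>Poly_Mapping.keys p. \<exists>u\<in>V. u mdvd a}" by blast
next
  fix p :: "('n, 'k) mpoly" assume p: "p \<in> {p. \<forall>a\<in>Poly_Mapping.keys p. \<exists>u\<in>V. u mdvd a}"
  have "\<not> u pdvd 0" if "u \<in> V" for u
    using that assms(3) mdvd_antisym[of u 0] by (auto dest: pdvd_imp_mdvd)
  then have empty: "{} \<in> buchberger_faces V"
    by (simp add: buchberger_faces_def)
  define C where "C F = (if F = {} then p else 0)" for F :: "'n monom set"
  obtain z where z: "z \<in> free_mod (faces (buchberger_faces V) 0)"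
    and bd_z: "\<And>G. G \<subseteq> V \<Longrightarrow> boundary V r (dehomogenize z) G = C G"
  proof (rule ex_boundary_eq[OF V, of C 0])
    show "boundary V r C G = 0" for G
      by (simp add: boundary_def C_def)
  qed (use p empty in \<open>auto simp: C_def split: if_splits\<close>)
  have "aug z = p"
    using aug_eq_boundary[OF V(1) z, of r] bd_z[of "{}"] by (simp add: C_def)
  then show "p \<in> aug ` free_mod (faces (buchberger_faces V) 0)"
    using z by blast
qed

theorem free_resolution_buchberger:
  fixes I :: "('n::finite, 'k::field) mpoly set"
  assumes I: "monomial_ideal I" "I \<noteq> UNIV" and r: "linear_order_on (min_gens I) r"
  shows "free_resolution I (faces (buchberger_complex I)) mlcm (bd r) aug"
proof -
  define V where "V = min_gens I"
  have V: "finite V" "linear_order_on V r" "0 \<notin> V"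
    using finite_min_gens r zero_notin_min_gens[OF I] by (auto simp: V_def)
  have I_eq: "I = {p. \<forall>a\<in>Poly_Mapping.keys p. \<exists>u\<in>V. u mdvd a}"
    using monomial_ideal_mem_iff[OF I(1)] by (auto simp: V_def)
  have "homogeneous mlcm a (bd r (Suc i) z)"
    if "z \<in> free_mod (faces (buchberger_faces V) (Suc i))" "homogeneous mlcm a z"
    for i a and z :: "'n monom set \<Rightarrow>\<^sub>0 ('n, 'k) mpoly"
    using homogeneous_boundary[OF that(2), of V r]
      dehomogenize_bd[OF V(1) keys_faces_buchberger[OF that(1)], of "Suc i" r]
    by (simp add: homogeneous_def flip: dehomogenize_def)
  moreover have "\<exists>c. aug z = Poly_Mapping.single a c"
    if "z \<in> free_mod (faces (buchberger_faces V) 0)" "homogeneous mlcm a z"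
    for a and z :: "'n monom set \<Rightarrow>\<^sub>0 ('n, 'k) mpoly"
    using homogeneous_boundary[OF that(2), of V r "{}"] aug_eq_boundary[OF V(1) that(1), of r] by simp
  moreover have "aug ` free_mod (faces (buchberger_faces V) 0) = I"
    using image_aug_buchberger[OF V] I_eq by simp
  moreover have "buchberger_complex I = buchberger_faces V"
    by (simp add: buchberger_complex_def buchberger_faces_def V_def)
  moreover have "module_hom smult smult (bd r i :: ('n monom set \<Rightarrow>\<^sub>0 ('n, 'k) mpoly) \<Rightarrow> _)" for i
    by (rule module_hom_bd)
  moreover have "module_hom smult (*) (aug :: ('n monom set \<Rightarrow>\<^sub>0 ('n, 'k) mpoly) \<Rightarrow> _)"
    by (rule module_hom_aug)
  moreover have "bd r 1 ` free_mod (faces (buchberger_faces V) 1)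
      = {z :: 'n monom set \<Rightarrow>\<^sub>0 ('n, 'k) mpoly. z \<in> free_mod (faces (buchberger_faces V) 0) \<and> aug z = 0}"
    by (rule image_bd_1_buchberger[OF V(1,2)])
  moreover have "bd r (i + 2) ` free_mod (faces (buchberger_faces V) (i + 2))
      = {z :: 'n monom set \<Rightarrow>\<^sub>0 ('n, 'k) mpoly.
          z \<in> free_mod (faces (buchberger_faces V) (i + 1)) \<and> bd r (i + 1) z = 0}" for i
    using image_bd_buchberger[OF V(1,2), of i] by simp
  ultimately show ?thesis
    unfolding free_resolution_def by simp
qed

lemma mem_max_ideal_span_iff:
  "x \<in> fmod.span {smult p v | p v. p \<in> max_ideal \<and> v \<in> free_mod B}
    \<longleftrightarrow> x \<in> free_mod B \<and> (\<forall>b. Poly_Mapping.lookup x b \<in> max_ideal)"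
proof
  assume "x \<in> fmod.span {smult p v | p v. p \<in> max_ideal \<and> v \<in> free_mod B}"
  then show "x \<in> free_mod B \<and> (\<forall>b. Poly_Mapping.lookup x b \<in> max_ideal)"
  proof (induction rule: fmod.span_induct_alt)
    case base
    show ?case by (simp add: mem_free_mod_iff mem_max_ideal_iff)
  next
    case (step c x y)
    then obtain p v where x: "x = smult p v" "p \<in> max_ideal" "v \<in> free_mod B" by blast
    have "c * (p * Poly_Mapping.lookup v b) + Poly_Mapping.lookup y b \<in> max_ideal" for b
      using x(2) step.IH unfolding max_ideal_def
      by (metis mult.commute poly.span_add poly.span_scale)
    moreover have "smult c x + y \<in> free_mod B"
      using x(1,3) step.IH unfolding mem_free_mod_iff lookup_add x(1) lookup_smult
      by (metis add_0_right mult_zero_right)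
    ultimately show ?case
      by (simp add: x(1) lookup_add mult.assoc del: poly.scale_scale)
  qed
next
  assume x: "x \<in> free_mod B \<and> (\<forall>b. Poly_Mapping.lookup x b \<in> max_ideal)"
  have "(\<Sum>b\<in>Poly_Mapping.keys x. smult (Poly_Mapping.lookup x b) (Poly_Mapping.single b 1))
    \<in> fmod.span {smult p v | p v. p \<in> max_ideal \<and> v \<in> free_mod B}"
  proof (rule fmod.span_sum, rule fmod.span_base)
    fix b assume "b \<in> Poly_Mapping.keys x"
    then have "Poly_Mapping.single b 1 \<in> free_mod B"
      using x by (auto simp: free_mod_def)
    then show "smult (Poly_Mapping.lookup x b) (Poly_Mapping.single b 1)
        \<in> {smult p v | p v. p \<in> max_ideal \<and> v \<in> free_mod B}"
      using x by blast
  qed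
  moreover have "(\<Sum>b\<in>Poly_Mapping.keys x. smult (Poly_Mapping.lookup x b) (Poly_Mapping.single b 1)) = x"
    by (rule poly_mapping_eqI) (simp add: lookup_sum lookup_single when_def in_keys_iff if_distrib cong: if_cong)
  ultimately show "x \<in> fmod.span {smult p v | p v. p \<in> max_ideal \<and> v \<in> free_mod B}"
    by simp
qed

text \<open>The constant term at \<open>G\<close> of a boundary is read off from the embedding in degree \<open>m\<^sub>G\<close>; faces over \<open>G\<close>
  with a strictly larger label do not contribute to it.\<close>

lemma constant_coeff_bd:
  assumes V: "finite V" "Poly_Mapping.keys z \<subseteq> Pow V" and "i \<noteq> 0"
  shows "Poly_Mapping.lookup (Poly_Mapping.lookup (bd r i z) G) 0
    = (\<Sum>v\<in>V - G. vsign r v G * Poly_Mapping.lookup (dehomogenize z (insert v G)) (mlcm G))"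
proof -
  have "Poly_Mapping.lookup (Poly_Mapping.lookup (bd r i z) G) 0
      = Poly_Mapping.lookup (dehomogenize (bd r i z) G) (mlcm G)"
    by (simp add: dehomogenize_def lookup_times_mon)
  also have "\<dots> = (\<Sum>v\<in>V - G. vsign r v G * Poly_Mapping.lookup (dehomogenize z (insert v G)) (mlcm G))"
    unfolding dehomogenize_bd[OF assms] lookup_boundary by (simp add: boundary_def)
  finally show ?thesis .
qed

text \<open>Minimality says that no boundary has a nonzero constant term. A face whose label survives the removal
  of a vertex produces the constant term \<open>\<plusminus>1\<close>, and nothing else can.\<close>

lemma bd_minimal_iff:
  fixes V :: "'n::finite monom set"
  assumes V: "finite V"
  shows "(\<forall>i. bd r (Suc i) ` free_mod (faces (buchberger_faces V) (Suc i)) \<subseteq>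
      fmod.span {smult p v | (p :: ('n, 'k::field) mpoly) v.
        p \<in> max_ideal \<and> v \<in> free_mod (faces (buchberger_faces V) i)}) \<longleftrightarrow>
    (\<forall>F\<in>buchberger_faces V. \<forall>v\<in>F. F \<noteq> {v} \<longrightarrow> mlcm (F - {v}) \<noteq> mlcm F)"
    (is "?minimal \<longleftrightarrow> ?strict")
proof
  assume ?minimal
  show ?strict
  proof (intro ballI impI notI)
    fix F v assume F: "F \<in> buchberger_faces V" "v \<in> F" "F \<noteq> {v}" "mlcm (F - {v}) = mlcm F"
    define G where "G = F - {v}"
    have FV: "F \<subseteq> V" "finite F"
      using buchberger_faces_D(1)[OF F(1)] V finite_subset by auto
    have "G \<noteq> {}"
      using F(2,3) by (auto simp: G_def)
    then have "card G \<noteq> 0"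
      using FV by (simp add: G_def)
    then obtain i where i: "card G = Suc i"
      by (meson not0_implies_Suc)
    then have "F \<in> faces (buchberger_faces V) (Suc i)"
      using F(1) card_Suc_Diff1[OF FV(2) F(2)] V by (simp add: faces_buchberger flip: G_def)
    then have z: "Poly_Mapping.single F (1 :: ('n, 'k) mpoly) \<in> free_mod (faces (buchberger_faces V) (Suc i))"
      by (simp add: free_mod_def)
    let ?z = "Poly_Mapping.single F (1 :: ('n, 'k) mpoly)"
    have "Poly_Mapping.lookup (bd r (Suc i) ?z) G \<in> max_ideal"
      using subsetD[OF spec[OF \<open>?minimal\<close>, of i] imageI[OF z]]
      unfolding mem_max_ideal_span_iff by simp
    then have "0 = (\<Sum>w\<in>V - G. vsign r w G * Poly_Mapping.lookup (dehomogenize ?z (insert w G)) (mlcm G))"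
      using constant_coeff_bd[OF V keys_faces_buchberger[OF z], of "Suc i" r G] by (simp add: mem_max_ideal_iff)
    also have "\<dots> = (\<Sum>w\<in>V - G. if w = v then vsign r v G else 0)"
    proof (rule sum.cong[OF refl])
      fix w assume w: "w \<in> V - G"
      show "vsign r w G * Poly_Mapping.lookup (dehomogenize ?z (insert w G)) (mlcm G)
          = (if w = v then vsign r v G else 0)"
      proof (cases "w = v")
        case True
        then have "insert w G = F" using F(2) by (auto simp: G_def)
        then show ?thesis
          using True F(4) by (simp add: dehomogenize_def mon_def G_def)
      next
        case False
        then have "insert w G \<noteq> F" using w F(2) by (auto simp: G_def)
        then show ?thesis
          using False by (simp add: dehomogenize_def lookup_single)
      qed
    qed
    also have "\<dots> = vsign r v G"
      using F(2) FV V by (subst sum.delta) (auto simp: G_def)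
    finally have "vsign r v G = (0 :: 'k)" by simp
    then have "vsign r v G * vsign r v G = (0 :: 'k)" by (simp only: mult_zero_left)
    then show False by simp
  qed
next
  assume strict: ?strict
  show ?minimal
  proof (intro allI image_subsetI)
    fix i and z :: "'n monom set \<Rightarrow>\<^sub>0 ('n, 'k) mpoly"
    assume z: "z \<in> free_mod (faces (buchberger_faces V) (Suc i))"
    have "vsign r v G * Poly_Mapping.lookup (dehomogenize z (insert v G)) (mlcm G) = 0"
      if v: "v \<in> V - G" for v G
    proof (rule ccontr)
      assume "vsign r v G * Poly_Mapping.lookup (dehomogenize z (insert v G)) (mlcm G) \<noteq> 0"
      then have key: "mlcm G \<in> Poly_Mapping.keys (dehomogenize z (insert v G))"
        by (auto simp: in_keys_iff)
      then have "dehomogenize z (insert v G) \<noteq> 0" by auto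
      then have face: "insert v G \<in> buchberger_faces V" "card (insert v G) = Suc (Suc i)"
        using z V by (auto simp: dehomogenize_eq_0_iff mem_free_mod_iff faces_buchberger)
      have "finite (insert v G)"
        using face(2) card_gt_0_iff by fastforce
      then have "mlcm G = mlcm (insert v G)"
        using keys_dehomogenize[OF key] mlcm_mono[of "insert v G" G] mdvd_antisym by blast
      moreover have "insert v G \<noteq> {v}"
      proof
        assume eq: "insert v G = {v}"
        have "card {v} = Suc (Suc i)" using face(2) unfolding eq .
        then show False by simp
      qed
      ultimately show False
        using strict face(1) v by (metis Diff_iff Diff_insert_absorb insertI1)
    qed
    then have "Poly_Mapping.lookup (bd r (Suc i) z) G \<in> max_ideal" for G
      unfolding mem_max_ideal_iff constant_coeff_bd[OF V keys_faces_buchberger[OF z] nat.simps(3)]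
      by (intro sum.neutral) blast
    then show "bd r (Suc i) z \<in> fmod.span {smult p v | p v. p \<in> max_ideal \<and>
        v \<in> free_mod (faces (buchberger_faces V) i)}"
      unfolding mem_max_ideal_span_iff using bd_mem_free_mod[OF V z] by simp
  qed
qed

text \<open>If \<open>F\<close> and \<open>G\<close> have the same label and no generator divides it properly, then the union of \<open>F\<close> and \<open>G\<close>
  is a face with this label, and it keeps the label after removal of a vertex not shared by both.
  It is not that vertex alone, whose label would then be \<open>1\<close>.\<close>

lemma strict_labels_iff:
  assumes V: "finite V" and "0 \<notin> V"
  shows "(\<forall>F\<in>buchberger_faces V. \<forall>v\<in>F. F \<noteq> {v} \<longrightarrow> mlcm (F - {v}) \<noteq> mlcm F) \<longleftrightarrow>
    (\<forall>F G. F \<subseteq> V \<and> G \<subseteq> V \<and> F \<noteq> G \<and> mlcm F = mlcm G \<longrightarrow> (\<exists>u\<in>V. u pdvd mlcm F))"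
    (is "?strict \<longleftrightarrow> ?unique")
proof
  assume strict: ?strict
  have fin: "finite F" if "F \<subseteq> V" for F
    using V that finite_subset by blast
  have *: "\<exists>u\<in>V. u pdvd mlcm F" 
    if FG: "F \<subseteq> V" "G \<subseteq> V" "\<not> F \<subseteq> G" "mlcm F = mlcm G" for F G
  proof (rule ccontr)
    assume no_pdvd: "\<not> ?thesis"
    obtain v where v: "v \<in> F" "v \<notin> G" using FG(3) by blast
    define H where "H = F \<union> G"
    have H: "H \<subseteq> V" "finite H" "v \<in> H" "G \<subseteq> H - {v}"
      using that v fin by (auto simp: H_def)
    have lcm_le: "mlcm H mdvd mlcm G"
      using fin[OF that(1)] fin[OF that(2)] that(4) mdvd_mlcm unfolding H_def
      by (subst mlcm_mdvd_iff) (auto, metis)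
    have "mlcm G mdvd mlcm (H - {v})" "mlcm (H - {v}) mdvd mlcm H"
      using H by (auto intro: mlcm_mono)
    then have eq: "mlcm (H - {v}) = mlcm H" "mlcm H = mlcm F"
      using lcm_le that(4) mdvd_antisym mdvd_trans by metis+
    have "H \<noteq> {v}"
    proof
      assume "H = {v}"
      then have "v = 0" using eq(1) by simp
      then show False using \<open>0 \<notin> V\<close> H by auto
    qed
    moreover have "H \<in> buchberger_faces V"
      using H(1) no_pdvd eq(2) by (simp add: buchberger_faces_def)
    ultimately show False
      using strict H(3) eq(1) by blast
  qed
  show ?unique
    using * by (metis subset_antisym)
next
  assume unique: ?unique
  show ?strict
  proof (intro ballI impI notI)
    fix F v assume F: "F \<in> buchberger_faces V" "v \<in> F" "F \<noteq> {v}" "mlcm (F - {v}) = mlcm F"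
    have "F \<subseteq> V" "F - {v} \<subseteq> V" "F \<noteq> F - {v}"
      using F(2) buchberger_faces_D(1)[OF F(1)] by auto
    then have "\<exists>u\<in>V. u pdvd mlcm F"
      using unique F(4) by metis
    then show False
      using buchberger_faces_D(2)[OF F(1)] by blast
  qed
qed

theorem proposition1p13:
  fixes I :: "('n::finite, 'k::field) mpoly set"
    and r :: "'n monom rel"
  assumes "monomial_ideal I" and "I \<noteq> UNIV"
    and "linear_order_on (min_gens I) r"
  shows "minimal_free_resolution I (faces (buchberger_complex I)) mlcm (bd r) aug \<longleftrightarrow>
    (\<forall>F G. F \<subseteq> min_gens I \<and> G \<subseteq> min_gens I \<and> F \<noteq> G \<and> mlcm F = mlcm G \<longrightarrow>
       (\<exists>u\<in>min_gens I. u pdvd mlcm F))"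
proof -
  have complex: "buchberger_complex I = buchberger_faces (min_gens I)"
    by (simp add: buchberger_complex_def buchberger_faces_def)
  show ?thesis
    using free_resolution_buchberger[OF assms] bd_minimal_iff[OF finite_min_gens, of r I, where ?'k = 'k]
      strict_labels_iff[OF finite_min_gens zero_notin_min_gens[OF assms(1,2)]]
    by (simp only: minimal_free_resolution_def complex simp_thms)
qed

end
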